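(* Let $d\geq 2$, $\vec\lambda\in(0,\infty)^d$ and $m\in\mathbb{R}^d$ a unit vector, and let $D=\{x\in\mathbb{Z}^d:m\cdot x\geq 0\}$. If $\log\vec\lambda\neq-\|\log\vec\lambda\|\,m$, then $\gamma(H^D)>0$.
   Context: Model (single-species PVBS model). Fix $d\geq 2$ and $\vec\lambda\in(0,\infty)^d$; write $\log\vec\lambda=(\log\lambda_1,\ldots,\log\lambda_d)$. Let $e_1,\ldots,e_d$ be the canonical basis of $\mathbb{Z}^d$. Each site $x$ carries $\mathcal{H}_x=\mathbb{C}^2$ with orthonormal basis $|0\rangle,|1\rangle$; for finite $\Lambda\subset\mathbb{Z}^d$, $\mathcal{H}_\Lambda=\bigotimes_{x\in\Lambda}\mathcal{H}_x$. For $\lambda>0$ let $\phi^{(\lambda)}=(|01\rangle-\lambda|10\rangle)/\sqrt{1+\lambda^2}\in\mathcal{H}_x\otimes\mathcal{H}_{x+e_j}$ (first tensor factor at $x$), and $h_{x,x+e_j}=|\phi^{(\lambda_j)}\rangle\langle\phi^{(\lambda_j)}|+|11\rangle\langle 11|$. For finite $\Lambda$, $H^\Lambda=\sum_{j=1}^d\sum_{x:\,x,x+e_j\in\Lambda}h_{x,x+e_j}$. Half-space Hamiltonian: $H^D$ denotes the Hamiltonian in the GNS representation of the product state in which every site of $D$ is in state $|0\rangle$: its Hilbert space is the closure of the span of product vectors with only finitely many sites of $D$ in state $|1\rangle$, and $H^D$ is the self-adjoint closure of $\sum_{j}\sum_{x,x+e_j\in D}h_{x,x+e_j}$ on this span;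 $H^D\geq 0$ with one-dimensional kernel spanned by the all-$|0\rangle$ vector. Spectral gap: for $H\geq 0$ with $0\in\operatorname{spec}(H)$, $\gamma(H)=\sup\{\delta>0:\operatorname{spec}(H)\cap(0,\delta)=\emptyset\}$, with $\gamma(H)=0$ if no such $\delta$ exists. (Note that the hypothesis excludes $\vec\lambda=(1,\ldots,1)$.) *)

theory Defs
  imports "HOL-Analysis.Analysis"
begin

text \<open>Sites are points of Z^d, represented as int^'d. The GNS Hilbert space of the
all-|0> product state on D has the orthonormal basis of product vectors indexed by the
finite sets S of sites of D that are in state |1>; a vector is a square-summable
coefficient function on these configurations.\<close>

definition halfspace :: "real^'d \<Rightarrow> (int^'d) set" where
  "halfspace m = {x. (\<Sum>j\<in>UNIV. m$j * real_of_int (x$j)) \<ge> 0}"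

definition configs :: "(int^'d) set \<Rightarrow> (int^'d) set set" where
  "configs D = {S. finite S \<and> S \<subseteq> D}"

definition l2 :: "(int^'d) set \<Rightarrow> ((int^'d) set \<Rightarrow> complex) set" where
  "l2 D = {\<psi>. (\<forall>S. S \<notin> configs D \<longrightarrow> \<psi> S = 0) \<and> (\<lambda>S. (cmod (\<psi> S))^2) summable_on UNIV}"

definition l2norm :: "((int^'d) set \<Rightarrow> complex) \<Rightarrow> real" where
  "l2norm \<psi> = sqrt (\<Sum>\<^sub>\<infinity>S. (cmod (\<psi> S))^2)"

definition fin_vecs :: "(int^'d) set \<Rightarrow> ((int^'d) set \<Rightarrow> complex) set" where
  "fin_vecs D = {\<psi>. (\<forall>S. S \<notin> configs D \<longrightarrow> \<psi> S = 0) \<and> finite {S. \<psi> S \<noteq> 0}}"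

text \<open>Coefficients of phi^(l) = (|01> - l|10>)/sqrt(1+l^2) in the basis |ab>
  (a = occupation of the first site x, b = occupation of x+e_j).\<close>
definition phi :: "real \<Rightarrow> bool \<times> bool \<Rightarrow> real" where
  "phi l ab = (if ab = (False, True) then 1 / sqrt (1 + l^2)
               else if ab = (True, False) then - l / sqrt (1 + l^2) else 0)"

definition hmat :: "real \<Rightarrow> bool \<times> bool \<Rightarrow> bool \<times> bool \<Rightarrow> real" where
  "hmat l s t = phi l s * phi l t + (if s = (True, True) \<and> t = (True, True) then 1 else 0)"

definition setpair :: "(int^'d) set \<Rightarrow> int^'d \<Rightarrow> bool \<Rightarrow> int^'d \<Rightarrow> bool \<Rightarrow> (int^'d) set" where
  "setpair S x a y b = (S - {x, y}) \<union> {z. (z = x \<and> a) \<or> (z = y \<and> b)}"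

definition hloc :: "real \<Rightarrow> int^'d \<Rightarrow> int^'d \<Rightarrow> ((int^'d) set \<Rightarrow> complex) \<Rightarrow> (int^'d) set \<Rightarrow> complex" where
  "hloc l x y \<psi> S = (\<Sum>t\<in>UNIV. complex_of_real (hmat l (x \<in> S, y \<in> S) t) * \<psi> (setpair S x (fst t) y (snd t)))"

definition edges :: "(int^'d) set \<Rightarrow> ((int^'d) \<times> 'd) set" where
  "edges D = {(x, j). x \<in> D \<and> x + axis j 1 \<in> D}"

text \<open>The formal Hamiltonian sum_j sum_{x,x+e_j in D} h_{x,x+e_j} (for finitely supported
  vectors only finitely many terms are nonzero at each configuration).\<close>
definition H0 :: "real^'d \<Rightarrow> (int^'d) set \<Rightarrow> ((int^'d) set \<Rightarrow> complex) \<Rightarrow> (int^'d) set \<Rightarrow> complex" where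
  "H0 lam D \<psi> S = (\<Sum>\<^sub>\<infinity>(x, j)\<in>edges D. hloc (lam$j) x (x + axis j 1) \<psi> S)"

definition HD_graph :: "real^'d \<Rightarrow> (int^'d) set \<Rightarrow> (((int^'d) set \<Rightarrow> complex) \<times> ((int^'d) set \<Rightarrow> complex)) set" where
  "HD_graph lam D = {(\<psi>, \<eta>). \<psi> \<in> l2 D \<and> \<eta> \<in> l2 D \<and>
     (\<exists>f. (\<forall>n. f n \<in> fin_vecs D) \<and>
          (\<lambda>n. l2norm (\<lambda>S. f n S - \<psi> S)) \<longlonglongrightarrow> 0 \<and>
          (\<lambda>n. l2norm (\<lambda>S. H0 lam D (f n) S - \<eta> S)) \<longlonglongrightarrow> 0)}"

definition in_resolvent :: "(('a \<Rightarrow> complex) \<times> ('a \<Rightarrow> complex)) set \<Rightarrow> ('a \<Rightarrow> complex) set \<Rightarrow> (('a \<Rightarrow> complex) \<Rightarrow> real) \<Rightarrow> real \<Rightarrow> bool" where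
  "in_resolvent G V nrm \<mu> \<longleftrightarrow> (\<exists>R.
     (\<forall>\<phi>\<in>V. R \<phi> \<in> V) \<and>
     (\<forall>\<phi>\<in>V. \<forall>\<phi>'\<in>V. \<forall>a b. R (\<lambda>s. a * \<phi> s + b * \<phi>' s) = (\<lambda>s. a * R \<phi> s + b * R \<phi>' s)) \<and>
     (\<exists>C. \<forall>\<phi>\<in>V. nrm (R \<phi>) \<le> C * nrm \<phi>) \<and>
     (\<forall>\<phi>\<in>V. (R \<phi>, \<lambda>s. \<phi> s + complex_of_real \<mu> * R \<phi> s) \<in> G) \<and>
     (\<forall>(\<psi>, \<eta>)\<in>G. R (\<lambda>s. \<eta> s - complex_of_real \<mu> * \<psi> s) = \<psi>))"

text \<open>Real spectrum (the spectrum of the self-adjoint H^D is real).\<close>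
definition HD_spectrum :: "real^'d \<Rightarrow> (int^'d) set \<Rightarrow> real set" where
  "HD_spectrum lam D = {\<mu>. \<not> in_resolvent (HD_graph lam D) (l2 D) l2norm \<mu>}"

definition spectral_gap :: "real set \<Rightarrow> ereal" where
  "spectral_gap sp = (if \<exists>\<delta>>0. sp \<inter> {0<..<\<delta>} = {}
     then Sup {ereal \<delta> | \<delta>. \<delta> > 0 \<and> sp \<inter> {0<..<\<delta>} = {}} else 0)"

end

theory Submission
  imports Defs "HOL-Combinatorics.Transposition"
begin

text \<open>The Hamiltonian conserves the number of particles, so the gap reduces to a bound
  E(f) \<ge> \<gamma> |f|^2 for the energy form E on finitely supported f vanishing on the vacuum, with
  \<gamma> independent of the particle number.

  Let b = log \<lambda>. Unless b is a nonpositive multiple of m, some lattice vector v satisfies b \<cdot> v > 0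
  and m \<cdot> v > 0, and v is reached from 0 by a path inside the half-space using only the steps
  \<sigma>_j e_j, where \<sigma>_j is the sign of v_j. In a nonempty configuration S choose a particle maximising
  x \<mapsto> \<Sum> \<sigma>_j x_j and move it along this path. It stays strictly ahead of all other particles, so
  every step is an admissible hop, and S can be recovered from the image. Each hop multiplies the
  amplitude by \<lambda>_j^{\<plusminus>1} up to an error controlled by the energy, so for the total displacement T
  one gets exp (b \<cdot> v) |f| \<le> |f \<circ> T| + K E(f)^{1/2} \<le> |f| + K E(f)^{1/2}, which is the bound.

  For 0 < \<mu> < \<gamma> the resolvent is built without the spectral theorem: after flipping the sign
  of the vacuum component, H - \<mu> is coercive, and it is bounded on vectors with at most n
  particles, so Richardson iteration shows that it has dense range.\<close>

section \<open>Square-summable coefficient functions\<close>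

definition square_summable :: "((int^'d) set \<Rightarrow> complex) \<Rightarrow> bool" where
  "square_summable f \<longleftrightarrow> (\<lambda>S. (cmod (f S))^2) summable_on UNIV"

lemma l2norm_nonneg [simp]: "0 \<le> l2norm f"
  unfolding l2norm_def by (simp add: infsum_nonneg)

lemma L2_set_le_l2norm:
  assumes "square_summable f" "finite F"
  shows "L2_set (\<lambda>S. cmod (f S)) F \<le> l2norm f"
  unfolding L2_set_def l2norm_def
  by (rule real_sqrt_le_mono)
    (use assms in \<open>auto simp: square_summable_def intro!: finite_sum_le_infsum\<close>)

text \<open>A uniform bound on all finite partial norms yields summability and the norm bound
  together, so the triangle inequality, completeness and truncation all reduce to
  \<open>L2_set\<close> on finite sets.\<close>

lemma square_summable_bounded:
  assumes "\<And>F. finite F \<Longrightarrow> L2_set (\<lambda>S. cmod (f S)) F \<le> C"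
  shows "square_summable f" "l2norm f \<le> C"
proof -
  have C: "C \<ge> 0" using assms[of "{}"] by simp
  have bd: "(\<Sum>S\<in>F. (cmod (f S))^2) \<le> C^2" if "finite F" for F
    using assms[OF that] C unfolding L2_set_def
    by (metis real_sqrt_le_iff real_sqrt_unique)
  have s: "(\<lambda>S. (cmod (f S))^2) summable_on UNIV"
    by (rule nonneg_bdd_above_summable_on) (use bd in \<open>auto intro!: bdd_aboveI\<close>)
  then show "square_summable f" by (simp add: square_summable_def)
  have "(\<Sum>\<^sub>\<infinity>S. (cmod (f S))^2) \<le> C^2"
    by (rule infsum_le_finite_sums[OF s]) (use bd in auto)
  then show "l2norm f \<le> C" unfolding l2norm_def
    using C by (metis real_sqrt_le_iff real_sqrt_unique)
qed

lemma l2norm_sum_le: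
  assumes "square_summable f" "square_summable g"
  shows "square_summable (\<lambda>S. f S + g S)" "l2norm (\<lambda>S. f S + g S) \<le> l2norm f + l2norm g"
proof -
  have "L2_set (\<lambda>S. cmod (f S + g S)) F \<le> l2norm f + l2norm g" if "finite F" for F
  proof -
    have "L2_set (\<lambda>S. cmod (f S + g S)) F \<le> L2_set (\<lambda>S. cmod (f S) + cmod (g S)) F"
      by (rule L2_set_mono) (auto simp: norm_triangle_ineq)
    also have "\<dots> \<le> L2_set (\<lambda>S. cmod (f S)) F + L2_set (\<lambda>S. cmod (g S)) F"
      by (rule L2_set_triangle_ineq)
    finally show ?thesis
      using L2_set_le_l2norm[OF assms(1) that] L2_set_le_l2norm[OF assms(2) that] by linarith
  qed
  from square_summable_bounded[OF this]
  show "square_summable (\<lambda>S. f S + g S)" "l2norm (\<lambda>S. f S + g S) \<le> l2norm f + l2norm g" by auto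
qed

lemma l2norm_scale:
  "l2norm (\<lambda>S. c * f S) = cmod c * l2norm f"
  unfolding l2norm_def
  by (simp add: norm_mult power_mult_distrib infsum_cmult_right' real_sqrt_mult)

lemma square_summable_scale:
  "square_summable f \<Longrightarrow> square_summable (\<lambda>S. c * f S)"
  unfolding square_summable_def
  by (simp add: norm_mult power_mult_distrib summable_on_cmult_right)

lemma square_summable_diff:
  assumes "square_summable f" "square_summable g"
  shows "square_summable (\<lambda>S. f S - g S)"
  using l2norm_sum_le(1)[OF assms(1) square_summable_scale[OF assms(2), of "-1"]] by simp

lemma l2norm_diff_le:
  assumes "square_summable f" "square_summable g"
  shows "l2norm (\<lambda>S. f S - g S) \<le> l2norm f + l2norm g"
  using l2norm_sum_le(2)[OF assms(1) square_summable_scale[OF assms(2), of "-1"]]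
    l2norm_scale[of "-1" g] by simp

lemma l2norm_minus_commute: "l2norm (\<lambda>S. f S - g S) = l2norm (\<lambda>S. g S - f S)"
  unfolding l2norm_def by (simp add: norm_minus_commute)

lemma l2norm_triangle_diff:
  assumes "square_summable f" "square_summable g" "square_summable h"
  shows "l2norm (\<lambda>S. f S - h S) \<le> l2norm (\<lambda>S. f S - g S) + l2norm (\<lambda>S. g S - h S)"
  using l2norm_sum_le(2)[OF square_summable_diff[OF assms(1,2)] square_summable_diff[OF assms(2,3)]]
  by simp

lemma l2norm_finite_support:
  assumes "finite F" "\<And>S. S \<notin> F \<Longrightarrow> f S = 0"
  shows "square_summable f" "l2norm f = L2_set (\<lambda>S. cmod (f S)) F"
proof -
  have *: "((\<lambda>S. (cmod (f S))^2) has_sum (\<Sum>S\<in>F. (cmod (f S))^2)) UNIV"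
    by (rule has_sum_cong_neutral[THEN iffD1, OF _ _ _ has_sum_finite[OF assms(1)]]) (use assms(2) in auto)
  show "square_summable f" using * by (auto simp: square_summable_def summable_on_def)
  show "l2norm f = L2_set (\<lambda>S. cmod (f S)) F"
    using infsumI[OF *] by (simp add: l2norm_def L2_set_def)
qed

lemma norm_le_l2norm:
  assumes "square_summable f"
  shows "cmod (f S) \<le> l2norm f"
  using L2_set_le_l2norm[OF assms, of "{S}"] by simp

lemma l2norm_eq_0:
  assumes "square_summable f" "l2norm f = 0"
  shows "f S = 0"
  using norm_le_l2norm[OF assms(1), of S] assms(2) by simp

text \<open>Each coordinate is dominated by the norm, so coordinatewise limits exist. Norm
  convergence then follows by letting k tend to infinity on finite sets of configurations.\<close>

lemma l2_complete:
  assumes ss: "\<And>n::nat. square_summable (f n)"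
    and cau: "\<And>e. e > 0 \<Longrightarrow> \<exists>N. \<forall>n\<ge>N. \<forall>k\<ge>N. l2norm (\<lambda>S. f n S - f k S) < e"
  obtains g where "square_summable g" "(\<lambda>n. l2norm (\<lambda>S. f n S - g S)) \<longlonglongrightarrow> 0"
    "\<And>S. (\<lambda>n. f n S) \<longlonglongrightarrow> g S"
proof -
  have "Cauchy (\<lambda>n. f n S)" for S
    unfolding Cauchy_altdef2 dist_norm
  proof (intro allI impI)
    fix e :: real assume "e > 0"
    from cau[OF this] obtain N where N: "\<forall>n\<ge>N. \<forall>k\<ge>N. l2norm (\<lambda>S. f n S - f k S) < e" by blast
    have "norm (f n S - f N S) < e" if "n \<ge> N" for n
      using norm_le_l2norm[OF square_summable_diff[OF ss[of n] ss[of N]], of S] N that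
      by (meson le_less_trans order_refl)
    then show "\<exists>N. \<forall>n\<ge>N. norm (f n S - f N S) < e" by blast
  qed
  then have "\<exists>g. \<forall>S. (\<lambda>n. f n S) \<longlonglongrightarrow> g S"
    by (meson Cauchy_convergent convergent_def)
  then obtain g where g: "\<And>S. (\<lambda>n. f n S) \<longlonglongrightarrow> g S" by blast
  have close: "\<exists>N. \<forall>n\<ge>N. square_summable (\<lambda>S. f n S - g S) \<and> l2norm (\<lambda>S. f n S - g S) \<le> e"
    if e: "e > 0" for e
  proof -
    from cau[OF e] obtain N where N: "\<forall>n\<ge>N. \<forall>k\<ge>N. l2norm (\<lambda>S. f n S - f k S) < e" by blast
    have "L2_set (\<lambda>S. cmod (f n S - g S)) F \<le> e" if "n \<ge> N" "finite F" for n F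
    proof (rule LIMSEQ_le_const2)
      show "(\<lambda>k. L2_set (\<lambda>S. cmod (f n S - f k S)) F) \<longlonglongrightarrow> L2_set (\<lambda>S. cmod (f n S - g S)) F"
        unfolding L2_set_def by (intro tendsto_intros g)
      show "\<exists>N. \<forall>k\<ge>N. L2_set (\<lambda>S. cmod (f n S - f k S)) F \<le> e"
        using N that L2_set_le_l2norm[OF square_summable_diff[OF ss ss] that(2)]
        by (meson less_eq_real_def order_trans)
    qed
    then show ?thesis using square_summable_bounded[of "\<lambda>S. f _ S - g S" e] by blast
  qed
  from close[of 1] obtain N where N: "square_summable (\<lambda>S. f N S - g S)" by auto
  \<comment> \<open>The limit is \<open>f N\<close> minus the square-summable difference
    \<open>f N - g\<close>.\<close>
  have "square_summable g" using square_summable_diff[OF ss N, of N] by simp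
  moreover have "(\<lambda>n. l2norm (\<lambda>S. f n S - g S)) \<longlonglongrightarrow> 0"
  proof (rule LIMSEQ_I)
    fix r :: real assume "r > 0"
    then show "\<exists>no. \<forall>n\<ge>no. norm (l2norm (\<lambda>S. f n S - g S) - 0) < r"
      using close[of "r/2"] by fastforce
  qed
  ultimately show ?thesis using that g by blast
qed

text \<open>Finite partial sums of the squares come close to the total, and their deficit controls
  the mass outside F. This supplies the density of finitely supported vectors.\<close>

lemma l2_truncation:
  assumes "square_summable f" "e > 0"
  obtains F where "finite F" "l2norm (\<lambda>S. f S - (if S \<in> F then f S else 0)) < e"
proof -
  let ?q = "\<lambda>S. (cmod (f S))^2"
  have s: "(?q has_sum infsum ?q UNIV) UNIV"
    using assms(1) by (simp add: square_summable_def)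
  have "\<forall>\<^sub>F F in finite_subsets_at_top UNIV. dist (sum ?q F) (infsum ?q UNIV) < (e/2)^2"
    using s assms(2) unfolding has_sum_def by (intro tendstoD) auto
  then obtain F where F: "finite F" "\<And>F'. finite F' \<Longrightarrow> F \<subseteq> F' \<Longrightarrow> dist (sum ?q F') (infsum ?q UNIV) < (e/2)^2"
    unfolding eventually_finite_subsets_at_top by auto
  \<comment> \<open>Half of e is aimed at because the finite-sum criterion yields only a weak
    inequality.\<close>
  have "l2norm (\<lambda>S. f S - (if S \<in> F then f S else 0)) \<le> e/2"
  proof (rule square_summable_bounded)
    fix F' :: "(int^'a) set set" assume F': "finite F'"
    have "(\<Sum>S\<in>F'. (cmod (f S - (if S \<in> F then f S else 0)))^2) = sum ?q (F' - F)"
      by (rule sum.mono_neutral_cong_right) (use F' in auto)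
    also have "\<dots> = sum ?q (F \<union> F') - sum ?q F"
      using F(1) F' by (metis Un_Diff_cancel add_diff_cancel_left' Diff_disjoint finite_Diff sum.union_disjoint)
    also have "\<dots> \<le> infsum ?q UNIV - sum ?q F"
      using finite_sum_le_infsum[of ?q UNIV "F \<union> F'"] assms(1) F(1) F'
      by (auto simp: square_summable_def)
    also have "\<dots> \<le> (e/2)^2" using F(2)[of F] F(1) by (simp add: dist_real_def)
    finally show "L2_set (\<lambda>S. cmod (f S - (if S \<in> F then f S else 0))) F' \<le> e/2"
      unfolding L2_set_def using assms(2) by (intro real_le_lsqrt) auto
  qed
  with assms(2) have "l2norm (\<lambda>S. f S - (if S \<in> F then f S else 0)) < e" by linarith
  with F(1) show ?thesis by (rule that)
qed

section \<open>Edge terms and the Hamiltonian on finitely supported vectors\<close>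

text \<open>The two-site matrix is block diagonal in the particle number: 1 on 11, 0 on 00, and on
  the span of 10 and 01 the rank-one projection onto phi. Exchanging 10 and 01 is the transposition
  of x and y applied to the configuration.\<close>

lemma hloc_eq:
  assumes "x \<noteq> y"
  shows "hloc l x y \<psi> S =
    (if x \<in> S \<and> y \<in> S then \<psi> S
     else if x \<in> S then complex_of_real (l / (1 + l^2)) * (complex_of_real l * \<psi> S - \<psi> (Transposition.transpose x y ` S))
     else if y \<in> S then complex_of_real (1 / (1 + l^2)) * (\<psi> S - complex_of_real l * \<psi> (Transposition.transpose x y ` S))
     else 0)"
proof -
  have U: "(UNIV::(bool \<times> bool) set) = {(False,False),(False,True),(True,False),(True,True)}" by auto
  have pos: "1 + l^2 > 0" by (simp add: add_pos_nonneg)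
  have sq: "sqrt (1 + l^2) * sqrt (1 + l^2) = 1 + l^2" using pos by simp
  have nz: "sqrt (1 + l^2) \<noteq> 0" using pos by simp
  have c: "complex_of_real (1 + l^2) \<noteq> 0" using pos by (simp only: of_real_eq_0_iff)
  have TT: "setpair S x True y True = S" if "x \<in> S" "y \<in> S"
    using that by (auto simp: setpair_def)
  have same10: "setpair S x True y False = S" if "x \<in> S" "y \<notin> S"
    using that by (auto simp: setpair_def)
  have same01: "setpair S x False y True = S" if "x \<notin> S" "y \<in> S"
    using that by (auto simp: setpair_def)
  have sw10: "setpair S x False y True = Transposition.transpose x y ` S" if "x \<in> S" "y \<notin> S"
    using that assms by (auto simp: setpair_def Transposition.transpose_def image_iff split: if_splits)
  have sw01: "setpair S x True y False = Transposition.transpose x y ` S" if "x \<notin> S" "y \<in> S"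
    using that assms by (auto simp: setpair_def Transposition.transpose_def image_iff split: if_splits)
  show ?thesis
    using TT same10 same01 sw10 sw01
    unfolding hloc_def U hmat_def phi_def
    by (auto simp: sq algebra_simps power2_eq_square add_divide_distrib diff_divide_distrib
        simp flip: of_real_mult)
qed

section \<open>Edges touching a configuration and hops along them\<close>

text \<open>These are the only edges whose term can contribute to the coefficient at S, since the 00
  row of the edge matrix vanishes; the formal sum defining \<open>H0\<close> is therefore finite
  there.\<close>

definition touching :: "(int^'d) set \<Rightarrow> (int^'d) set \<Rightarrow> ((int^'d) \<times> 'd) set" where
  "touching D S = {(x, j) \<in> edges D. x \<in> S \<or> x + axis j 1 \<in> S}"

abbreviation hop :: "(int^'d) \<times> 'd \<Rightarrow> (int^'d) set \<Rightarrow> (int^'d) set" where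
  "hop e S \<equiv> Transposition.transpose (fst e) (fst e + axis (snd e) 1) ` S"

abbreviation hedge :: "real^'d \<Rightarrow> (int^'d) \<times> 'd \<Rightarrow> ((int^'d) set \<Rightarrow> complex) \<Rightarrow> (int^'d) set \<Rightarrow> complex" where
  "hedge lam e \<equiv> hloc (lam $ snd e) (fst e) (fst e + axis (snd e) 1)"

lemma neighbour_neq: "x \<noteq> x + axis j (1::int)" for x :: "int^'d"
  by (simp add: vec_eq_iff axis_def)

text \<open>In each coordinate direction a particle can be the first or the second endpoint of an
  edge, which accounts for the factor 2d per particle.\<close>

lemma finite_card_touching:
  fixes S :: "(int^'d) set"
  assumes "finite S"
  shows "finite (touching D S)" "card (touching D S) \<le> 2 * CARD('d) * card S"
proof -
  let ?A = "S \<times> (UNIV :: 'd set)"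
  let ?g = "\<lambda>(y::int^'d, j). (y - axis j 1, j)"
  have sub: "touching D S \<subseteq> ?A \<union> ?g ` ?A"
  proof
    fix e assume e: "e \<in> touching D S"
    obtain x j where xj: "e = (x, j)" by (cases e)
    then consider "x \<in> S" | "x + axis j 1 \<in> S" using e by (auto simp: touching_def)
    then show "e \<in> ?A \<union> ?g ` ?A"
    proof cases
      case 2
      have "e = ?g (x + axis j 1, j)" using xj by simp
      with 2 show ?thesis by blast
    qed (use xj in auto)
  qed
  have f: "finite ?A" using assms by simp
  show "finite (touching D S)" using sub f by (meson finite_UnI finite_imageI finite_subset)
  have "card (touching D S) \<le> card (?A \<union> ?g ` ?A)" using sub f by (intro card_mono) auto
  also have "\<dots> \<le> card ?A + card (?g ` ?A)" by (rule card_Un_le)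
  also have "\<dots> \<le> card ?A + card ?A" using card_image_le[OF f] by simp
  finally show "card (touching D S) \<le> 2 * CARD('d) * card S"
    by (simp add: card_cartesian_product algebra_simps)
qed

lemma transpose_image_image [simp]:
  "Transposition.transpose x y ` Transposition.transpose x y ` S = S"
  by (simp add: image_image)

lemma hop_configs [simp]:
  assumes "e \<in> edges D"
  shows "hop e S \<in> configs D \<longleftrightarrow> S \<in> configs D"
proof -
  have "hop e S \<in> configs D" if "S \<in> configs D" for S
    using that assms by (auto simp: configs_def edges_def Transposition.transpose_def)
  then show ?thesis by (metis transpose_image_image)
qed

lemma touching_hop [simp]: "e \<in> touching D (hop e S) \<longleftrightarrow> e \<in> touching D S"
  by (cases e) (auto simp: touching_def image_iff Transposition.transpose_def split: if_splits)

lemma card_hop [simp]: "card (hop e S) = card S"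
  by (intro card_image inj_on_subset[OF inj_transpose]) auto

lemma hedge_not_touching:
  "e \<in> edges D \<Longrightarrow> e \<notin> touching D S \<Longrightarrow> hedge lam e f S = 0"
  by (auto simp: hloc_eq neighbour_neq touching_def)

text \<open>Every entry of the edge matrix has modulus at most 1, whatever lambda is.\<close>

lemma norm_hedge_le: "cmod (hedge lam e f S) \<le> cmod (f S) + cmod (f (hop e S))"
proof -
  let ?l = "lam $ snd e"
  have pos: "1 + ?l^2 > 0" by (simp add: add_pos_nonneg)
  have ratio: "\<bar>a / (1 + ?l^2)\<bar> \<le> 1" if "\<bar>a\<bar> \<le> 1 + ?l^2" for a
    unfolding abs_divide abs_of_pos[OF pos] using that pos by (simp only: divide_le_eq_1_pos)
  \<comment> \<open>Expanding this square gives 2|l| \<le> 1 + l^2, more than is needed for the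
    off-diagonal entries.\<close>
  have "0 \<le> (\<bar>?l\<bar> - 1)^2" by (rule zero_le_power2)
  also have "\<dots> = ?l^2 - 2 * \<bar>?l\<bar> + 1" by (simp add: power2_diff)
  finally have "\<bar>?l\<bar> \<le> 1 + ?l^2" using pos by linarith
  note a1 = ratio[OF this]
  have a2: "\<bar>?l / (1 + ?l^2) * ?l\<bar> \<le> 1"
    using ratio[of "?l * ?l"] by (simp add: power2_eq_square)
  have a3: "\<bar>1 / (1 + ?l^2)\<bar> \<le> 1" by (rule ratio) simp
  have gen: "cmod (complex_of_real a * f S - complex_of_real b * f T) \<le> cmod (f S) + cmod (f T)"
    if "\<bar>a\<bar> \<le> 1" "\<bar>b\<bar> \<le> 1" for a b T
  proof -
    have "cmod (complex_of_real a * f S - complex_of_real b * f T) \<le> \<bar>a\<bar> * cmod (f S) + \<bar>b\<bar> * cmod (f T)"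
      using norm_triangle_ineq4[of "complex_of_real a * f S" "complex_of_real b * f T"]
      by (simp only: norm_mult norm_of_real)
    also have "\<dots> \<le> 1 * cmod (f S) + 1 * cmod (f T)"
      using that by (intro add_mono mult_right_mono) auto
    finally show ?thesis by simp
  qed
  have e1: "complex_of_real (?l / (1 + ?l^2)) * (complex_of_real ?l * f S - f T)
      = complex_of_real (?l / (1 + ?l^2) * ?l) * f S - complex_of_real (?l / (1 + ?l^2)) * f T" for T
    by (simp only: of_real_mult right_diff_distrib mult.assoc)
  have e2: "complex_of_real (1 / (1 + ?l^2)) * (f S - complex_of_real ?l * f T)
      = complex_of_real (1 / (1 + ?l^2)) * f S - complex_of_real (1 / (1 + ?l^2) * ?l) * f T" for T
    by (simp only: of_real_mult right_diff_distrib mult.assoc)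
  have a4: "\<bar>1 / (1 + ?l^2) * ?l\<bar> \<le> 1" using a1 by simp
  consider "fst e \<in> S" "fst e + axis (snd e) 1 \<in> S" | "fst e \<in> S" "fst e + axis (snd e) 1 \<notin> S"
    | "fst e \<notin> S" "fst e + axis (snd e) 1 \<in> S" | "fst e \<notin> S" "fst e + axis (snd e) 1 \<notin> S"
    by blast
  then show ?thesis
  proof cases
    case 1
    then show ?thesis by (simp add: hloc_eq[OF neighbour_neq])
  next
    case 2
    show ?thesis unfolding hloc_eq[OF neighbour_neq] e1 e2
      using 2 gen[OF a2 a1, of "hop e S"] by (simp only: if_True if_False simp_thms)
  next
    case 3
    show ?thesis unfolding hloc_eq[OF neighbour_neq] e1 e2
      using 3 gen[OF a3 a4, of "hop e S"] by (simp only: if_True if_False simp_thms)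
  next
    case 4
    then show ?thesis by (simp add: hloc_eq[OF neighbour_neq])
  qed
qed

section \<open>The Hamiltonian at a configuration, its support and its norm at bounded particle
  number\<close>

lemma H0_finite_sum:
  assumes "finite S"
  shows "H0 lam D f S = (\<Sum>e\<in>touching D S. hedge lam e f S)"
proof -
  have "H0 lam D f S = (\<Sum>\<^sub>\<infinity>e\<in>edges D. hedge lam e f S)"
    by (simp add: H0_def case_prod_unfold)
  also have "\<dots> = (\<Sum>\<^sub>\<infinity>e\<in>touching D S. hedge lam e f S)"
    by (rule infsum_cong_neutral) (auto simp: touching_def hloc_eq neighbour_neq)
  finally show ?thesis using finite_card_touching(1)[OF assms] by simp
qed

lemma H0_outside:
  assumes f: "f \<in> fin_vecs D" and S: "S \<notin> configs D"
  shows "H0 lam D f S = 0"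
proof -
  have "hedge lam e f S = 0" if "e \<in> edges D" for e
  proof -
    have "hop e S \<notin> configs D" using S that by simp
    then have "f S = 0" "f (hop e S) = 0" using f S by (auto simp: fin_vecs_def)
    with norm_hedge_le[of lam e f S] show ?thesis by simp
  qed
  then show ?thesis by (simp add: H0_def case_prod_unfold infsum_0)
qed

text \<open>The support grows by at most one hop, and hops keep the number of particles. Finiteness
  of the support of H f and conservation of a particle bound are both read off from this.\<close>

lemma H0_nonzero_cases:
  assumes f: "f \<in> fin_vecs D" and S: "H0 lam D f S \<noteq> 0"
  obtains "f S \<noteq> 0" | e where "e \<in> touching D (hop e S)" "f (hop e S) \<noteq> 0"
proof -
  have "S \<in> configs D" using H0_outside[OF f, of S lam] S by blast
  then have "finite S" by (simp add: configs_def)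
  from S have "(\<Sum>e\<in>touching D S. hedge lam e f S) \<noteq> 0" unfolding H0_finite_sum[OF \<open>finite S\<close>] .
  then obtain e where e: "e \<in> touching D S" "hedge lam e f S \<noteq> 0"
    by (rule sum.not_neutral_contains_not_neutral)
  then have "e \<in> touching D (hop e S)" by simp
  moreover have "f S \<noteq> 0 \<or> f (hop e S) \<noteq> 0"
  proof (rule ccontr)
    assume "\<not> (f S \<noteq> 0 \<or> f (hop e S) \<noteq> 0)"
    with norm_hedge_le[of lam e f S] e(2) show False by simp
  qed
  ultimately show ?thesis using that by blast
qed

lemma H0_fin_vecs:
  assumes f: "f \<in> fin_vecs D"
  shows "H0 lam D f \<in> fin_vecs D"
proof -
  let ?F = "{S. f S \<noteq> 0}"
  have "{S. H0 lam D f S \<noteq> 0} \<subseteq> ?F \<union> (\<Union>S\<in>?F. (\<lambda>e. hop e S) ` touching D S)"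
  proof
    fix S assume "S \<in> {S. H0 lam D f S \<noteq> 0}"
    then have "H0 lam D f S \<noteq> 0" by simp
    from H0_nonzero_cases[OF f this] show "S \<in> ?F \<union> (\<Union>S\<in>?F. (\<lambda>e. hop e S) ` touching D S)"
    proof cases
      case (2 e)
      have "S = hop e (hop e S)" by simp
      with 2 show ?thesis by blast
    qed auto
  qed
  moreover have "finite (?F \<union> (\<Union>S\<in>?F. (\<lambda>e. hop e S) ` touching D S))"
    using f by (auto simp: fin_vecs_def configs_def intro!: finite_card_touching)
  ultimately show ?thesis
    using H0_outside[OF f] by (auto simp: fin_vecs_def intro: finite_subset)
qed

lemma H0_card_le:
  assumes f: "f \<in> fin_vecs D" and n: "\<And>S. f S \<noteq> 0 \<Longrightarrow> card S \<le> n"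
    and S: "H0 lam D f S \<noteq> 0"
  shows "card S \<le> n"
  using f S
proof (cases rule: H0_nonzero_cases)
  case (2 e)
  from n[OF this(2)] show ?thesis by simp
qed (rule n)

lemma fin_vecs_linear:
  assumes "f \<in> fin_vecs D" "g \<in> fin_vecs D"
  shows "(\<lambda>S. a * f S + b * g S) \<in> fin_vecs D"
proof -
  have "{S. a * f S + b * g S \<noteq> 0} \<subseteq> {S. f S \<noteq> 0} \<union> {S. g S \<noteq> 0}" by auto
  then show ?thesis using assms by (auto simp: fin_vecs_def intro: finite_subset)
qed

lemma H0_linear:
  assumes "f \<in> fin_vecs D" "g \<in> fin_vecs D"
  shows "H0 lam D (\<lambda>S. a * f S + b * g S) S = a * H0 lam D f S + b * H0 lam D g S"
proof (cases "S \<in> configs D")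
  case True
  then have "finite S" by (simp add: configs_def)
  have "hedge lam e (\<lambda>S. a * f S + b * g S) S = a * hedge lam e f S + b * hedge lam e g S" for e
    by (simp add: hloc_def sum_distrib_left sum.distrib algebra_simps)
  then show ?thesis
    by (simp add: H0_finite_sum[OF \<open>finite S\<close>] sum.distrib sum_distrib_left)
next
  case False
  then show ?thesis by (simp add: H0_outside assms fin_vecs_linear)
qed

text \<open>No edge touches the empty configuration, so the vacuum coefficient of H f is zero for
  every f. This is why the vacuum component can later be treated separately.\<close>

lemma H0_empty: "H0 lam D f {} = 0"
  by (simp add: H0_finite_sum touching_def)

text \<open>A Schur-type estimate: Cauchy-Schwarz over the at most B = 2dn touching edges costs B,
  splitting (a + b)^2 \<le> 2a^2 + 2b^2 leaves two double sums, each at most B |f|^2. Together this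
  is 4B^2 = (4dn)^2.\<close>

lemma H0_bounded:
  fixes D :: "(int^'d) set"
  assumes f: "f \<in> fin_vecs D" and n: "\<And>S. f S \<noteq> 0 \<Longrightarrow> card S \<le> n" and F: "finite F"
    and G: "finite G" "\<And>S. f S \<noteq> 0 \<Longrightarrow> S \<in> G"
  shows "(\<Sum>S\<in>F. (cmod (H0 lam D f S))^2) \<le> (real (4 * CARD('d) * n))^2 * (\<Sum>S\<in>G. (cmod (f S))^2)"
proof -
  define B where "B = 2 * real CARD('d) * n"
  let ?G = "{S. f S \<noteq> 0}"
  have finG: "finite ?G" by (rule finite_subset[OF _ G(1)]) (use G(2) in blast)
  have fin: "finite S" if "f S \<noteq> 0" for S using f that by (auto simp: fin_vecs_def configs_def)
  define F' where "F' = {S\<in>F. H0 lam D f S \<noteq> 0}"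
  have F': "finite F'" "\<And>S. S \<in> F' \<Longrightarrow> finite S" "\<And>S. S \<in> F' \<Longrightarrow> card S \<le> n"
  proof -
    show "finite F'" using F by (simp add: F'_def)
    fix S assume "S \<in> F'"
    then have S: "H0 lam D f S \<noteq> 0" by (simp add: F'_def)
    then have "S \<in> configs D" using H0_outside[OF f, of S lam] by blast
    then show "finite S" by (simp add: configs_def)
    show "card S \<le> n" using H0_card_le[OF f n S] by blast
  qed
  have cardB: "real (card (touching D S)) \<le> B" if "finite S" "card S \<le> n" for S
  proof -
    have "card (touching D S) \<le> 2 * CARD('d) * n"
      using finite_card_touching(2)[OF that(1), of D] mult_le_mono2[OF that(2)] by (rule le_trans)
    then have "real (card (touching D S)) \<le> real (2 * CARD('d) * n)" by (rule of_nat_mono)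
    then show ?thesis by (simp add: B_def)
  qed
  have B0: "B \<ge> 0" by (simp add: B_def)
  have one: "(cmod (H0 lam D f S))^2 \<le> B * (\<Sum>e\<in>touching D S. 2 * (cmod (f S))^2 + 2 * (cmod (f (hop e S)))^2)"
    if "S \<in> F'" for S
  proof -
    let ?t = "\<lambda>e. cmod (f S) + cmod (f (hop e S))"
    have "cmod (H0 lam D f S) \<le> (\<Sum>e\<in>touching D S. ?t e)"
      unfolding H0_finite_sum[OF F'(2)[OF that]] by (rule sum_norm_le) (rule norm_hedge_le)
    then have "(cmod (H0 lam D f S))^2 \<le> (\<Sum>e\<in>touching D S. ?t e)^2"
      by (intro power_mono) auto
    also have "\<dots> = (\<Sum>e\<in>touching D S. 1 * ?t e)^2" by simp
    also have "\<dots> \<le> (\<Sum>e\<in>touching D S. 1^2) * (\<Sum>e\<in>touching D S. (?t e)^2)"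
      by (rule Cauchy_Schwarz_ineq_sum)
    also have "\<dots> \<le> B * (\<Sum>e\<in>touching D S. 2 * (cmod (f S))^2 + 2 * (cmod (f (hop e S)))^2)"
    proof (intro mult_mono sum_mono)
      fix e show "(?t e)^2 \<le> 2 * (cmod (f S))^2 + 2 * (cmod (f (hop e S)))^2"
        using zero_le_power2[of "cmod (f S) - cmod (f (hop e S))"] by (simp add: power2_eq_square algebra_simps)
    qed (use cardB[OF F'(2,3)[OF that]] B0 in \<open>auto intro: sum_nonneg\<close>)
    finally show ?thesis .
  qed
  have diag: "(\<Sum>S\<in>?G. \<Sum>e\<in>touching D S. (cmod (f S))^2) \<le> B * (\<Sum>S\<in>?G. (cmod (f S))^2)"
    unfolding sum_distrib_left
  proof (rule sum_mono)
    fix S assume "S \<in> ?G"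
    then have "real (card (touching D S)) \<le> B" using cardB[of S] fin[of S] n[of S] by simp
    then show "(\<Sum>e\<in>touching D S. (cmod (f S))^2) \<le> B * (cmod (f S))^2"
      by (simp add: mult_right_mono)
  qed
  have d1: "(\<Sum>S\<in>F'. \<Sum>e\<in>touching D S. (cmod (f S))^2) \<le> (\<Sum>S\<in>?G. \<Sum>e\<in>touching D S. (cmod (f S))^2)"
  proof -
    have "(\<Sum>S\<in>F'. \<Sum>e\<in>touching D S. (cmod (f S))^2) = (\<Sum>S\<in>F' \<inter> ?G. \<Sum>e\<in>touching D S. (cmod (f S))^2)"
      by (rule sum.mono_neutral_right) (use F' in auto)
    also have "\<dots> \<le> (\<Sum>S\<in>?G. \<Sum>e\<in>touching D S. (cmod (f S))^2)"
      by (rule sum_mono2) (use finG in \<open>auto intro: sum_nonneg\<close>)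
    finally show ?thesis .
  qed
  have d2: "(\<Sum>S\<in>F'. \<Sum>e\<in>touching D S. (cmod (f (hop e S)))^2) \<le> (\<Sum>S\<in>?G. \<Sum>e\<in>touching D S. (cmod (f S))^2)"
  proof -
    \<comment> \<open>The map (S, e) to (hop e S, e) is an involution preserving the touching
      relation; it turns the sum of hopped amplitudes into part of the diagonal sum over the support
      of f.\<close>
    let ?P = "{(S,e). S \<in> F' \<and> e \<in> touching D S \<and> f (hop e S) \<noteq> 0}"
    let ?r = "\<lambda>(S,e). (hop e S, e)"
    have "(\<Sum>S\<in>F'. \<Sum>e\<in>touching D S. (cmod (f (hop e S)))^2)
        = (\<Sum>(S,e)\<in>Sigma F' (touching D). (cmod (f (hop e S)))^2)"
      by (rule sum.Sigma) (use F' finite_card_touching in auto)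
    also have "\<dots> = (\<Sum>(S,e)\<in>?P. (cmod (f (hop e S)))^2)"
      by (rule sum.mono_neutral_right) (use F' finite_card_touching in \<open>auto intro!: finite_SigmaI\<close>)
    also have "\<dots> = (\<Sum>(S,e)\<in>?r ` ?P. (cmod (f S))^2)"
    proof (subst sum.reindex)
      show "inj_on ?r ?P" by (rule inj_on_inverseI[of _ ?r]) auto
    qed (auto intro!: sum.cong)
    also have "\<dots> \<le> (\<Sum>(S,e)\<in>Sigma ?G (touching D). (cmod (f S))^2)"
    proof (rule sum_mono2)
      show "finite (Sigma ?G (touching D))" using finG fin finite_card_touching by (auto intro!: finite_SigmaI)
      show "?r ` ?P \<subseteq> Sigma ?G (touching D)"
      proof
        fix z assume "z \<in> ?r ` ?P"
        then obtain S e where z: "z = (hop e S, e)" "e \<in> touching D S" "f (hop e S) \<noteq> 0" by auto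
        have "e \<in> touching D (hop e S)" using z(2) by simp
        with z show "z \<in> Sigma ?G (touching D)" by blast
      qed
    qed auto
    also have "\<dots> = (\<Sum>S\<in>?G. \<Sum>e\<in>touching D S. (cmod (f S))^2)"
      by (rule sum.Sigma[symmetric]) (use finG fin finite_card_touching in auto)
    finally show ?thesis .
  qed
  have "(\<Sum>S\<in>F. (cmod (H0 lam D f S))^2) = (\<Sum>S\<in>F'. (cmod (H0 lam D f S))^2)"
    by (rule sum.mono_neutral_right) (use F in \<open>auto simp: F'_def\<close>)
  also have "\<dots> \<le> (\<Sum>S\<in>F'. B * (\<Sum>e\<in>touching D S. 2 * (cmod (f S))^2 + 2 * (cmod (f (hop e S)))^2))"
    by (intro sum_mono one)
  also have "\<dots> = B * (2 * (\<Sum>S\<in>F'. \<Sum>e\<in>touching D S. (cmod (f S))^2)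
      + 2 * (\<Sum>S\<in>F'. \<Sum>e\<in>touching D S. (cmod (f (hop e S)))^2))"
    by (simp only: sum.distrib flip: sum_distrib_left)
  also have "\<dots> \<le> B * (4 * (B * (\<Sum>S\<in>?G. (cmod (f S))^2)))"
    by (rule mult_left_mono) (use d1 d2 diag B0 in linarith)+
  also have "(\<Sum>S\<in>?G. (cmod (f S))^2) = (\<Sum>S\<in>G. (cmod (f S))^2)"
    by (rule sum.mono_neutral_left) (use G in auto)
  also have "B * (4 * (B * (\<Sum>S\<in>G. (cmod (f S))^2))) = (2 * B)^2 * (\<Sum>S\<in>G. (cmod (f S))^2)"
    by (simp add: power2_eq_square)
  also have "2 * B = real (4 * CARD('d) * n)" by (simp add: B_def)
  finally show ?thesis .
qed

section \<open>Energy and hops\<close>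

text \<open>The real part of the quadratic form of H at f; configurations outside the support of f
  would contribute zero.\<close>

definition energy :: "real^'d \<Rightarrow> (int^'d) set \<Rightarrow> ((int^'d) set \<Rightarrow> complex) \<Rightarrow> real" where
  "energy lam D f = (\<Sum>S | f S \<noteq> 0. Re (cnj (f S) * H0 lam D f S))"

text \<open>Pairing S (particle at x, none at y) with its exchanged partner, the edge form is a sum
  of squared overlaps with phi, plus |f S|^2 where both sites are occupied. All terms are
  nonnegative, so those outside W may be dropped.\<close>

lemma hedge_energy_ge:
  fixes f :: "(int^'d) set \<Rightarrow> complex"
  assumes F: "finite F" "\<And>S. f S \<noteq> 0 \<Longrightarrow> S \<in> F"
    and W: "finite W" "\<And>S. S \<in> W \<Longrightarrow> x \<in> S \<and> y \<notin> S" and "x \<noteq> y"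
  shows "(\<Sum>S\<in>W. (cmod (f (Transposition.transpose x y ` S) - l * f S))^2 / (1 + l^2))
    \<le> (\<Sum>S\<in>F. Re (cnj (f S) * hloc l x y f S))"
proof -
  let ?s = "\<lambda>S. Transposition.transpose x y ` S"
  let ?q = "\<lambda>S. Re (cnj (f S) * hloc l x y f S)"
  \<comment> \<open>F2 contains each S at which f S or f of the partner of S can be nonzero; A holds
    one representative of each pair, and G adds the partners so that sums over pairs stay inside a
    finite set.\<close>
  define F2 where "F2 = F \<union> ?s ` F \<union> W"
  define A where "A = {S\<in>F2. x \<in> S \<and> y \<notin> S}"
  define G where "G = F2 \<union> ?s ` A"
  have fin: "finite F2" "finite A" "finite G" using F W by (auto simp: F2_def A_def G_def)
  have mem: "x \<in> ?s S \<longleftrightarrow> y \<in> S" "y \<in> ?s S \<longleftrightarrow> x \<in> S" for S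
    by (auto simp: in_transpose_image_iff)
  have pos: "1 + l^2 > 0" by (simp add: add_pos_nonneg)
  have Re_scale: "Re (cnj z * (complex_of_real k * w)) = k * Re (cnj z * w)" for z w k
    by (simp add: algebra_simps)
  have pair: "?q S + ?q (?s S) = (cmod (f (?s S) - l * f S))^2 / (1 + l^2)"
    if "x \<in> S" "y \<notin> S" for S
  proof -
    have "?q S + ?q (?s S) = Re (cnj (f S) * (complex_of_real (l / (1 + l^2)) * (l * f S - f (?s S))))
       + Re (cnj (f (?s S)) * (complex_of_real (1 / (1 + l^2)) * (f (?s S) - l * f S)))"
      using that by (simp only: hloc_eq[OF \<open>x \<noteq> y\<close>] mem transpose_image_image if_True if_False simp_thms)
    also have "\<dots> = l / (1 + l^2) * Re (cnj (f S) * (l * f S - f (?s S)))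
       + 1 / (1 + l^2) * Re (cnj (f (?s S)) * (f (?s S) - l * f S))"
      unfolding Re_scale ..
    also have "\<dots> = (l * Re (cnj (f S) * (l * f S - f (?s S))) + Re (cnj (f (?s S)) * (f (?s S) - l * f S))) / (1 + l^2)"
      by (simp only: add_divide_distrib times_divide_eq_left mult_1_left)
    also have "l * Re (cnj (f S) * (l * f S - f (?s S))) + Re (cnj (f (?s S)) * (f (?s S) - l * f S))
        = (cmod (f (?s S) - l * f S))^2"
      unfolding cmod_power2 by (simp add: power2_eq_square algebra_simps)
    finally show ?thesis .
  qed
  \<comment> \<open>Off the pairs, double occupation gives |f S|^2, an empty edge gives 0, and an
    unpaired configuration with only y occupied lies outside F, where f vanishes.\<close>
  have rest: "?q S \<ge> 0" if "S \<in> G - (A \<union> ?s ` A)" for S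
  proof (cases "x \<in> S \<longleftrightarrow> y \<in> S")
    case True
    then show ?thesis by (simp add: hloc_eq[OF \<open>x \<noteq> y\<close>])
  next
    case False
    have "S \<in> F2" "S \<notin> A" "S \<notin> ?s ` A" using that by (auto simp: G_def)
    then have S: "x \<notin> S" "y \<in> S" using False by (auto simp: A_def)
    have "S \<notin> F"
    proof
      assume "S \<in> F"
      then have "?s S \<in> A" using S mem by (auto simp: A_def F2_def)
      then have "?s (?s S) \<in> ?s ` A" by (rule imageI)
      with \<open>S \<notin> ?s ` A\<close> show False by simp
    qed
    then have "f S = 0" using F by blast
    then show ?thesis by simp
  qed
  have "(\<Sum>S\<in>W. (cmod (f (?s S) - l * f S))^2 / (1 + l^2))
      \<le> (\<Sum>S\<in>A. (cmod (f (?s S) - l * f S))^2 / (1 + l^2))"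
    by (rule sum_mono2) (use fin W pos in \<open>auto simp: A_def F2_def\<close>)
  also have "\<dots> = (\<Sum>S\<in>A. ?q S) + (\<Sum>S\<in>A. ?q (?s S))"
    unfolding sum.distrib[symmetric] by (intro sum.cong refl pair[symmetric]) (auto simp: A_def)
  also have "(\<Sum>S\<in>A. ?q (?s S)) = (\<Sum>S\<in>?s ` A. ?q S)"
  proof -
    have "inj_on ?s A" by (rule inj_on_inverseI[of _ ?s]) simp
    then show ?thesis by (simp only: sum.reindex comp_def)
  qed
  also have "(\<Sum>S\<in>A. ?q S) + (\<Sum>S\<in>?s ` A. ?q S) = (\<Sum>S\<in>A \<union> ?s ` A. ?q S)"
    by (rule sum.union_disjoint[symmetric]) (use fin mem in \<open>auto simp: A_def\<close>)
  also have "\<dots> \<le> (\<Sum>S\<in>G. ?q S)"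
    by (rule sum_mono2) (use fin rest in \<open>auto simp: A_def G_def\<close>)
  also have "\<dots> = (\<Sum>S\<in>F. ?q S)"
  proof (rule sum.mono_neutral_right)
    show "\<forall>S\<in>G - F. ?q S = 0"
    proof
      fix S assume "S \<in> G - F"
      then have "f S = 0" using F(2) by blast
      then show "?q S = 0" by simp
    qed
  qed (use fin in \<open>auto simp: G_def F2_def\<close>)
  finally show ?thesis .
qed

text \<open>The energy is the sum of the edge forms, and distinct pairs of edge and configuration
  use distinct squares in it. The total defect of admissible hops is thus bounded with no factor
  counting particles or edges, which makes the gap uniform in the particle number.\<close>

lemma energy_ge_hops:
  fixes f :: "(int^'d) set \<Rightarrow> complex"
  assumes f: "f \<in> fin_vecs D" and P: "finite P"
    and hops: "\<And>e S. (e, S) \<in> P \<Longrightarrow> e \<in> edges D \<and> fst e \<in> S \<and> fst e + axis (snd e) 1 \<notin> S"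
  shows "(\<Sum>(e, S)\<in>P. (cmod (f (hop e S) - lam $ snd e * f S))^2 / (1 + (lam $ snd e)^2))
    \<le> energy lam D f"
proof -
  let ?F = "{S. f S \<noteq> 0}"
  let ?q = "\<lambda>e S. Re (cnj (f S) * hedge lam e f S)"
  let ?t = "\<lambda>e S. (cmod (f (hop e S) - lam $ snd e * f S))^2 / (1 + (lam $ snd e)^2)"
  have F: "finite ?F" "\<And>S. f S \<noteq> 0 \<Longrightarrow> finite S" using f by (auto simp: fin_vecs_def configs_def)
  \<comment> \<open>The edges touching the support recover the whole energy; those of P are added
    because the configurations in P may lie outside the support.\<close>
  define E where "E = (\<Union>S\<in>?F. touching D S) \<union> fst ` P"
  have E: "finite E" "E \<subseteq> edges D"
    using F P hops by (auto simp: E_def finite_card_touching(1)) (auto simp: touching_def)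
  have P_eq: "P = Sigma E (\<lambda>e. {S. (e, S) \<in> P})" by (force simp: E_def)
  have Pfin: "finite {S. (e, S) \<in> P}" for e
    by (rule finite_subset[OF _ finite_imageI[OF P, of snd]]) force
  have "(\<Sum>(e, S)\<in>P. ?t e S) = (\<Sum>e\<in>E. \<Sum>S | (e, S) \<in> P. ?t e S)"
    by (subst P_eq, subst sum.Sigma) (use E Pfin in auto)
  also have "\<dots> \<le> (\<Sum>e\<in>E. \<Sum>S\<in>?F. ?q e S)"
    by (intro sum_mono hedge_energy_ge) (use F Pfin hops neighbour_neq in auto)
  also have "\<dots> = (\<Sum>S\<in>?F. \<Sum>e\<in>E. ?q e S)" by (rule sum.swap)
  also have "\<dots> = energy lam D f"
    unfolding energy_def
  proof (rule sum.cong[OF refl])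
    fix S assume S: "S \<in> ?F"
    have "(\<Sum>e\<in>E. ?q e S) = (\<Sum>e\<in>touching D S. ?q e S)"
    proof (rule sum.mono_neutral_right)
      show "\<forall>e\<in>E - touching D S. ?q e S = 0"
        using E(2) hedge_not_touching[of _ D S lam f] by auto
    qed (use S E in \<open>auto simp: E_def\<close>)
    also have "\<dots> = Re (cnj (f S) * H0 lam D f S)"
      using F(2)[of S] S by (simp add: H0_finite_sum sum_distrib_left del: times_complex.sel)
    finally show "(\<Sum>e\<in>E. ?q e S) = Re (cnj (f S) * H0 lam D f S)" .
  qed
  finally show ?thesis .
qed

lemma energy_nonneg:
  assumes "f \<in> fin_vecs D"
  shows "energy lam D f \<ge> 0"
  using energy_ge_hops[OF assms, of "{}"] by simp

section \<open>Height of a site, the foremost particle and the push map\<close>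

text \<open>Used with a sign vector s: each step s_j e_j then raises the height by exactly
  one.\<close>

definition height :: "int^'d \<Rightarrow> int^'d \<Rightarrow> int" where
  "height s x = (\<Sum>j\<in>UNIV. s $ j * x $ j)"

lemma height_add [simp]: "height s (x + y) = height s x + height s y"
  by (simp add: height_def sum.distrib algebra_simps)

lemma height_diff [simp]: "height s (x - y) = height s x - height s y"
  by (simp add: height_def sum_subtractf algebra_simps)

lemma height_0 [simp]: "height s 0 = 0"
  by (simp add: height_def)

lemma sum_times_axis: "(\<Sum>j\<in>UNIV. g j * (axis i c :: 'a::comm_semiring_1 ^ 'd) $ j) = g i * c"
proof -
  have "(\<Sum>j\<in>UNIV. g j * (axis i c :: 'a ^ 'd) $ j) = (\<Sum>j\<in>UNIV. if j = i then g j * c else 0)"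
    by (intro sum.cong) (auto simp: axis_def)
  then show ?thesis by simp
qed

lemma height_axis [simp]: "height s (axis j c) = s $ j * c"
  by (simp add: height_def sum_times_axis)

text \<open>Ties between highest particles are broken by choice; only maximality of the height is
  used afterwards.\<close>

definition top_site :: "int^'d \<Rightarrow> (int^'d) set \<Rightarrow> int^'d" where
  "top_site s S = (SOME x. x \<in> S \<and> (\<forall>y\<in>S. height s y \<le> height s x))"

lemma top_site:
  assumes "finite S" "S \<noteq> {}"
  shows "top_site s S \<in> S" "y \<in> S \<Longrightarrow> height s y \<le> height s (top_site s S)"
proof -
  have "Max (height s ` S) \<in> height s ` S" using assms by (intro Max_in) auto
  then obtain x where x: "x \<in> S" "height s x = Max (height s ` S)" by auto
  have "\<exists>x. x \<in> S \<and> (\<forall>y\<in>S. height s y \<le> height s x)"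
    using x assms by (intro exI[of _ x]) auto
  from someI_ex[OF this]
  show "top_site s S \<in> S" "y \<in> S \<Longrightarrow> height s y \<le> height s (top_site s S)"
    unfolding top_site_def by auto
qed

definition push_top :: "int^'d \<Rightarrow> int^'d \<Rightarrow> (int^'d) set \<Rightarrow> (int^'d) set" where
  "push_top s v S = insert (top_site s S + v) (S - {top_site s S})"

lemma push_top_0 [simp]:
  assumes "finite S" "S \<noteq> {}"
  shows "push_top s 0 S = S"
  using top_site(1)[OF assms, of s] by (auto simp: push_top_def)

text \<open>The pushed site becomes the strict maximum of the height, so it can be recovered
  from the image.\<close>
lemma inj_on_push_top:
  assumes v: "v = 0 \<or> height s v > 0"
  shows "inj_on (push_top s v) {S. finite S \<and> S \<noteq> {}}"
proof (cases "v = 0")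
  case True
  then show ?thesis by (intro inj_onI) simp
next
  case False
  then have v: "height s v > 0" using v by simp
  show ?thesis
  proof (rule inj_onI)
    fix S T assume S: "S \<in> {S. finite S \<and> S \<noteq> {}}" and T: "T \<in> {S. finite S \<and> S \<noteq> {}}"
      and eq: "push_top s v S = push_top s v T"
    let ?p = "top_site s S" and ?q = "top_site s T"
    have pS: "?p \<in> S" "\<And>y. y \<in> S \<Longrightarrow> height s y \<le> height s ?p" using top_site[of S] S by auto
    have qT: "?q \<in> T" "\<And>y. y \<in> T \<Longrightarrow> height s y \<le> height s ?q" using top_site[of T] T by auto
    \<comment> \<open>In the image of T the site p + v is either the pushed site q + v or an old
      site, at most as high as q. The same holds with S and T exchanged, and a positive height of v
      excludes having the second alternative twice.\<close>
    have "?p + v \<in> push_top s v T" using eq unfolding push_top_def by blast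
    then have 1: "?p + v = ?q + v \<or> height s ?p + height s v \<le> height s ?q"
      using qT(2)[of "?p + v"] by (auto simp: push_top_def)
    have "?q + v \<in> push_top s v S" using eq unfolding push_top_def by blast
    then have 2: "?q + v = ?p + v \<or> height s ?q + height s v \<le> height s ?p"
      using pS(2)[of "?q + v"] by (auto simp: push_top_def)
    from 1 2 v have p: "?p = ?q" by auto
    have "?p + v \<notin> S - {?p}" "?p + v \<notin> T - {?p}"
      using pS(2)[of "?p + v"] qT(2)[of "?p + v"] v p by auto
    moreover have "insert (?p + v) (S - {?p}) = insert (?p + v) (T - {?p})"
      using eq by (simp only: push_top_def p)
    ultimately have "S - {?p} = T - {?p}" by (rule insert_ident[THEN iffD1])
    then have "insert ?p (S - {?p}) = insert ?q (T - {?q})" by (simp only: p)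
    then show "S = T" by (simp only: insert_Diff[OF pS(1)] insert_Diff[OF qT(1)])
  qed
qed

section \<open>Moving the foremost particle\<close>

text \<open>The landing site is free: for v = 0 it is the removed site itself, otherwise it is
  strictly higher than every site of S.\<close>

lemma push_site_notin:
  assumes S: "finite S" "S \<noteq> {}" and v: "v = 0 \<or> height s v > 0"
  shows "top_site s S + v \<notin> S - {top_site s S}"
  using top_site(2)[OF S, of "top_site s S + v" s] v by auto

lemma transpose_image_insert:
  assumes "a \<notin> R" "b \<notin> R"
  shows "Transposition.transpose a b ` insert a R = insert b R"
proof -
  have "Transposition.transpose a b ` R = R"
    using assms by (intro transpose_image_eq) simp
  then show ?thesis by simp
qed

lemma hop_push_top_up:
  assumes S: "finite S" "S \<noteq> {}" and v: "v = 0 \<or> height s v > 0" and j: "s $ j = 1"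
  defines "e \<equiv> (top_site s S + v, j)"
  shows "hop e (push_top s v S) = push_top s (v + axis j 1) S"
    "fst e \<in> push_top s v S" "fst e + axis (snd e) 1 \<notin> push_top s v S"
proof -
  have w: "height s (v + axis j 1) > 0" using v j by auto
  note n = push_site_notin[OF S v] push_site_notin[OF S disjI2, OF w]
  show "hop e (push_top s v S) = push_top s (v + axis j 1) S"
    using transpose_image_insert[OF n] by (simp add: e_def push_top_def add.assoc)
  show "fst e \<in> push_top s v S" by (simp add: e_def push_top_def)
  show "fst e + axis (snd e) 1 \<notin> push_top s v S"
    using n(2) neighbour_neq[of "top_site s S + v" j] by (simp add: e_def push_top_def add.assoc)
qed

text \<open>Edges point along +e_j, so for a negative step the edge starts at the new position of
  the particle. The hop is therefore read backwards, from the further push to the current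
  one.\<close>

lemma hop_push_top_down:
  assumes S: "finite S" "S \<noteq> {}" and v: "v = 0 \<or> height s v > 0" and j: "s $ j = - 1"
  defines "e \<equiv> (top_site s S + (v - axis j 1), j)"
  shows "hop e (push_top s (v - axis j 1) S) = push_top s v S"
    "fst e \<in> push_top s (v - axis j 1) S" "fst e + axis (snd e) 1 \<notin> push_top s (v - axis j 1) S"
proof -
  have w: "height s (v - axis j 1) > 0" using v j by auto
  note n = push_site_notin[OF S disjI2, OF w] push_site_notin[OF S v]
  show "hop e (push_top s (v - axis j 1) S) = push_top s v S"
    using transpose_image_insert[OF n] by (simp add: e_def push_top_def)
  show "fst e \<in> push_top s (v - axis j 1) S" by (simp add: e_def push_top_def)
  show "fst e + axis (snd e) 1 \<notin> push_top s (v - axis j 1) S"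
    using n(2) neighbour_neq[of "top_site s S + (v - axis j 1)" j]
    by (simp add: e_def push_top_def)
qed

text \<open>Injectivity of \<open>T\<close> makes the pairs of edge and configuration distinct, so
  each defect is charged to the energy once; with the direction j fixed, a single factor 1 +
  lambda_j^2 comes out.\<close>

lemma energy_ge_family_hops:
  fixes f :: "(int^'d) set \<Rightarrow> complex"
  assumes f: "f \<in> fin_vecs D" and Z: "finite Z" and inj: "inj_on T Z"
    and hops: "\<And>S. S \<in> Z \<Longrightarrow> (x S, j) \<in> edges D \<and> x S \<in> T S \<and> x S + axis j 1 \<notin> T S"
  shows "L2_set (\<lambda>S. cmod (f (hop (x S, j) (T S)) - lam $ j * f (T S))) Z
    \<le> sqrt (1 + (lam $ j)^2) * sqrt (energy lam D f)"
proof -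
  let ?l = "lam $ j"
  let ?g = "\<lambda>S. ((x S, j), T S)"
  let ?t = "\<lambda>S. (cmod (f (hop (x S, j) (T S)) - ?l * f (T S)))^2"
  have pos: "1 + ?l^2 > 0" by (simp add: add_pos_nonneg)
  have "inj_on ?g Z" using inj by (auto simp: inj_on_def)
  then have "(\<Sum>S\<in>Z. ?t S / (1 + ?l^2))
      = (\<Sum>(e, S)\<in>?g ` Z. (cmod (f (hop e S) - lam $ snd e * f S))^2 / (1 + (lam $ snd e)^2))"
    by (subst sum.reindex) auto
  also have "\<dots> \<le> energy lam D f"
    by (rule energy_ge_hops[OF f]) (use Z hops in auto)
  finally have "(\<Sum>S\<in>Z. ?t S) \<le> (1 + ?l^2) * energy lam D f"
    using pos by (simp add: pos_divide_le_eq mult.commute flip: sum_divide_distrib)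
  then show ?thesis
    unfolding L2_set_def real_sqrt_mult[symmetric] by (rule real_sqrt_le_mono)
qed

text \<open>The first bound serves steps along +e_j, where the later amplitude is close to l times
  the earlier one; the second serves steps along -e_j, where these roles are exchanged.\<close>

lemma L2_set_scaled_triangle:
  fixes a b :: "'a \<Rightarrow> complex"
  assumes "l \<ge> 0"
  shows "l * L2_set (\<lambda>S. cmod (a S)) Z \<le> L2_set (\<lambda>S. cmod (b S)) Z + L2_set (\<lambda>S. cmod (b S - of_real l * a S)) Z"
    "L2_set (\<lambda>S. cmod (b S)) Z \<le> l * L2_set (\<lambda>S. cmod (a S)) Z + L2_set (\<lambda>S. cmod (b S - of_real l * a S)) Z"
proof -
  have l: "l * L2_set (\<lambda>S. cmod (a S)) Z = L2_set (\<lambda>S. cmod (of_real l * a S)) Z"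
    using assms by (simp add: L2_set_right_distrib norm_mult)
  have "cmod (of_real l * a S) \<le> cmod (b S) + cmod (b S - of_real l * a S)" for S
    by (metis norm_triangle_sub norm_minus_commute add.commute)
  then have "L2_set (\<lambda>S. cmod (of_real l * a S)) Z \<le> L2_set (\<lambda>S. cmod (b S) + cmod (b S - of_real l * a S)) Z"
    by (intro L2_set_mono) auto
  also have "\<dots> \<le> L2_set (\<lambda>S. cmod (b S)) Z + L2_set (\<lambda>S. cmod (b S - of_real l * a S)) Z"
    by (rule L2_set_triangle_ineq)
  finally show "l * L2_set (\<lambda>S. cmod (a S)) Z \<le> L2_set (\<lambda>S. cmod (b S)) Z + L2_set (\<lambda>S. cmod (b S - of_real l * a S)) Z"
    unfolding l .
  have "cmod (b S) \<le> cmod (of_real l * a S) + cmod (b S - of_real l * a S)" for S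
    by (rule norm_triangle_sub)
  then have "L2_set (\<lambda>S. cmod (b S)) Z \<le> L2_set (\<lambda>S. cmod (of_real l * a S) + cmod (b S - of_real l * a S)) Z"
    by (intro L2_set_mono) auto
  also have "\<dots> \<le> L2_set (\<lambda>S. cmod (of_real l * a S)) Z + L2_set (\<lambda>S. cmod (b S - of_real l * a S)) Z"
    by (rule L2_set_triangle_ineq)
  finally show "L2_set (\<lambda>S. cmod (b S)) Z \<le> l * L2_set (\<lambda>S. cmod (a S)) Z + L2_set (\<lambda>S. cmod (b S - of_real l * a S)) Z"
    unfolding l .
qed

text \<open>One hop of the foremost particle multiplies the amplitude by lambda_j to the power s_j,
  up to an error controlled by the energy. The summands 1 and 1 / lambda_j in the constant cover
  positive and negative steps respectively.\<close>

lemma push_top_step: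
  fixes f :: "(int^'d) set \<Rightarrow> complex" and s :: "int^'d"
  assumes f: "f \<in> fin_vecs D" and Z: "finite Z" "Z \<subseteq> configs D - {{}}"
    and lam: "lam $ j > 0" and s: "s $ j = 1 \<or> s $ j = - 1"
    and v: "v = 0 \<or> height s v > 0"
    and D: "\<And>x. x \<in> D \<Longrightarrow> x + v \<in> D" "\<And>x. x \<in> D \<Longrightarrow> x + (v + axis j (s $ j)) \<in> D"
  shows "exp (ln (lam $ j) * s $ j) * L2_set (\<lambda>S. cmod (f (push_top s v S))) Z
    \<le> L2_set (\<lambda>S. cmod (f (push_top s (v + axis j (s $ j)) S))) Z
      + (1 + 1 / lam $ j) * sqrt (1 + (lam $ j)^2) * sqrt (energy lam D f)"
proof -
  let ?l = "lam $ j" and ?w = "v + axis j (s $ j)"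
  let ?a = "\<lambda>S. f (push_top s v S)" and ?b = "\<lambda>S. f (push_top s ?w S)"
  let ?R = "sqrt (1 + ?l^2) * sqrt (energy lam D f)"
  have R0: "?R \<ge> 0" using energy_nonneg[OF f] by (simp add: add_nonneg_nonneg)
  have Zfin: "finite S" "S \<noteq> {}" "top_site s S \<in> D" if "S \<in> Z" for S
    using that Z(2) top_site(1)[of S s] by (auto simp: configs_def)
  have hw: "height s ?w > 0" using v s by auto
  have inj: "inj_on (push_top s u) Z" if "u = 0 \<or> height s u > 0" for u
    by (rule inj_on_subset[OF inj_on_push_top[OF that]]) (use Zfin in auto)
  show ?thesis
  proof (cases "s $ j = 1")
    case True
    have "L2_set (\<lambda>S. cmod (f (hop (top_site s S + v, j) (push_top s v S)) - ?l * ?a S)) Z \<le> ?R"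
      by (rule energy_ge_family_hops[OF f Z(1) inj[OF v]])
        (use Zfin hop_push_top_up[OF _ _ v True] D True in \<open>auto simp: edges_def add.assoc\<close>)
    also have "L2_set (\<lambda>S. cmod (f (hop (top_site s S + v, j) (push_top s v S)) - ?l * ?a S)) Z
        = L2_set (\<lambda>S. cmod (?b S - ?l * ?a S)) Z"
      by (intro L2_set_cong refl) (simp only: hop_push_top_up(1)[OF Zfin(1,2) v True] True)
    finally have "?l * L2_set (\<lambda>S. cmod (?a S)) Z \<le> L2_set (\<lambda>S. cmod (?b S)) Z + ?R"
      using L2_set_scaled_triangle(1)[of ?l ?a Z ?b] lam by linarith
    moreover have "1 * ?R \<le> (1 + 1 / ?l) * ?R"
      by (rule mult_right_mono) (use R0 lam in auto)
    moreover have "exp (ln ?l * s $ j) = ?l" using True lam by simp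
    ultimately show ?thesis by (simp only: mult.assoc)
  next
    case False
    then have sj: "s $ j = - 1" using s by simp
    have w: "?w = v - axis j 1" unfolding sj by (simp add: vec_eq_iff axis_def)
    have "L2_set (\<lambda>S. cmod (f (hop (top_site s S + ?w, j) (push_top s ?w S)) - ?l * ?b S)) Z \<le> ?R"
    proof (rule energy_ge_family_hops[OF f Z(1) inj[OF disjI2[OF hw]]])
      fix S assume S: "S \<in> Z"
      have "top_site s S + v = top_site s S + ?w + axis j 1" by (simp add: w)
      then have "top_site s S + ?w + axis j 1 \<in> D" using D(1)[OF Zfin(3)[OF S]] by (simp only:)
      with D(2)[OF Zfin(3)[OF S]] have "(top_site s S + ?w, j) \<in> edges D" by (simp add: edges_def)
      with hop_push_top_down(2,3)[OF Zfin(1,2)[OF S] v sj]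
      show "(top_site s S + ?w, j) \<in> edges D \<and> top_site s S + ?w \<in> push_top s ?w S
          \<and> top_site s S + ?w + axis j 1 \<notin> push_top s ?w S"
        unfolding w by simp
    qed
    also have "L2_set (\<lambda>S. cmod (f (hop (top_site s S + ?w, j) (push_top s ?w S)) - ?l * ?b S)) Z
        = L2_set (\<lambda>S. cmod (?a S - ?l * ?b S)) Z"
      by (intro L2_set_cong refl) (simp only: hop_push_top_down(1)[OF Zfin(1,2) v sj] w)
    finally have "L2_set (\<lambda>S. cmod (?a S)) Z \<le> ?l * L2_set (\<lambda>S. cmod (?b S)) Z + ?R"
      using L2_set_scaled_triangle(2)[of ?l ?a Z ?b] lam by linarith
    \<comment> \<open>Division by lambda_j puts the earlier amplitude on the left and scales the
      error by 1 / lambda_j.\<close>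
    then have "1 / ?l * L2_set (\<lambda>S. cmod (?a S)) Z \<le> L2_set (\<lambda>S. cmod (?b S)) Z + 1 / ?l * ?R"
      using lam by (simp add: field_simps)
    moreover have "1 / ?l * ?R \<le> (1 + 1 / ?l) * ?R"
      by (rule mult_right_mono) (use R0 lam in auto)
    moreover have "exp (ln ?l * s $ j) = 1 / ?l" using sj lam by (simp add: exp_minus inverse_eq_divide)
    ultimately show ?thesis by (simp only: mult.assoc)
  qed
qed

section \<open>Lattice paths in the half-space and accumulated amplification\<close>

definition lin :: "real^'d \<Rightarrow> int^'d \<Rightarrow> real" where
  "lin c x = (\<Sum>j\<in>UNIV. c $ j * real_of_int (x $ j))"

lemma lin_add: "lin c (x + y) = lin c x + lin c y"
  by (simp add: lin_def sum.distrib algebra_simps)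

lemma lin_axis: "lin c (axis j k) = c $ j * real_of_int k"
proof -
  have "lin c (axis j k) = (\<Sum>i\<in>UNIV. if i = j then c $ j * real_of_int k else 0)"
    unfolding lin_def by (intro sum.cong) (auto simp: axis_def)
  then show ?thesis by simp
qed

lemma halfspace_add:
  assumes "x \<in> halfspace m" "lin m v \<ge> 0"
  shows "x + v \<in> halfspace m"
  using assms lin_add[of m x v] by (simp add: halfspace_def lin_def)

text \<open>A monotone lattice path from 0 to v that never leaves the half-space exists because the
  steps that increase the value of m can be taken first; read backwards, this picks the last step.\<close>
lemma monotone_predecessor:
  fixes s v :: "int^'d"
  assumes s: "\<And>j. s $ j = 1 \<or> s $ j = - 1"
    and v: "\<And>j. s $ j * v $ j \<ge> 0" "lin m v \<ge> 0" "v \<noteq> 0"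
  obtains j u where "v = u + axis j (s $ j)" "\<And>j. s $ j * u $ j \<ge> 0" "lin m u \<ge> 0"
proof -
  have ss: "s $ j * s $ j = 1" for j using s[of j] by auto
  obtain k where "v $ k \<noteq> 0" using v(3) by (auto simp: vec_eq_iff)
  then have k: "s $ k * v $ k > 0" using v(1)[of k] s[of k] by (smt (verit) mult_eq_0_iff)
  \<comment> \<open>Prefer a coordinate whose step does not increase m, since undoing it cannot
    lower the value of m. If there is none, every coordinate still travelled increases m.\<close>
  obtain j where j: "s $ j * v $ j > 0"
    and best: "m $ j * s $ j \<le> 0 \<or> (\<forall>i. s $ i * v $ i > 0 \<longrightarrow> m $ i * s $ i > 0)"
    using k by (metis not_le)
  let ?u = "v - axis j (s $ j)"
  have u: "s $ i * ?u $ i \<ge> 0" for i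
    using v(1)[of i] j ss[of j] by (cases "i = j") (auto simp: axis_def algebra_simps)
  have vu: "v = ?u + axis j (s $ j)" by simp
  have lin: "lin m v = lin m ?u + m $ j * s $ j"
    by (subst vu, subst lin_add) (simp add: lin_axis)
  have "lin m ?u \<ge> 0"
  proof (cases "m $ j * s $ j \<le> 0")
    case True
    with lin v(2) show ?thesis by linarith
  next
    case False
    then have all: "m $ i * s $ i > 0" if "s $ i * v $ i > 0" for i using best that by blast
    \<comment> \<open>Each term is nonnegative: m_i u_i = (m_i s_i)(s_i u_i) because s_i^2 = 1, and
      coordinates not travelled vanish.\<close>
    show ?thesis
      unfolding lin_def
    proof (rule sum_nonneg)
      fix i
      show "m $ i * real_of_int (?u $ i) \<ge> 0"
      proof (cases "s $ i * v $ i > 0")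
        case True
        have "m $ i * real_of_int (?u $ i) = (m $ i * s $ i) * real_of_int (s $ i * ?u $ i)"
          using s[of i] by auto
        also have "\<dots> \<ge> 0"
          by (rule mult_nonneg_nonneg[OF less_imp_le[OF all[OF True]]]) (use u[of i] in \<open>simp only: of_int_0_le_iff\<close>)
        finally show ?thesis .
      next
        case False
        then have "s $ i * v $ i = 0" using v(1)[of i] by linarith
        then have "v $ i = 0" using s[of i] by auto
        moreover have "i \<noteq> j" using False j by auto
        ultimately show ?thesis by (simp add: axis_def)
      qed
    qed
  qed
  with that[OF vu u] show ?thesis .
qed

text \<open>Induction on the height of v, the number of unit steps: the last step is peeled off and
  the factors of the steps multiply to the exponential of a sum. K is chosen before f and Z, hence
  is uniform in the particle number.\<close>

lemma push_top_lower_bound: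
  fixes s v :: "int^'d" and lam m :: "real^'d"
  assumes lam: "\<And>j. lam $ j > 0" and s: "\<And>j. s $ j = 1 \<or> s $ j = - 1"
    and v: "\<And>j. s $ j * v $ j \<ge> 0" "lin m v \<ge> 0"
  shows "\<exists>K\<ge>0. \<forall>f\<in>fin_vecs (halfspace m). \<forall>Z. finite Z \<longrightarrow> Z \<subseteq> configs (halfspace m) - {{}} \<longrightarrow>
    exp (lin (\<chi> j. ln (lam $ j)) v) * L2_set (\<lambda>S. cmod (f S)) Z
    \<le> L2_set (\<lambda>S. cmod (f (push_top s v S))) Z + K * sqrt (energy lam (halfspace m) f)"
  using v
proof (induction "nat (height s v)" arbitrary: v rule: less_induct)
  case less
  let ?D = "halfspace m" and ?b = "(\<chi> j. ln (lam $ j)) :: real^'d"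
  show ?case
  proof (cases "v = 0")
    case True
    have "L2_set (\<lambda>S. cmod (f (push_top s 0 S))) Z = L2_set (\<lambda>S. cmod (f S)) Z"
      if "Z \<subseteq> configs ?D - {{}}" for Z and f :: "(int^'d) set \<Rightarrow> complex"
    proof (intro L2_set_cong refl)
      fix S assume "S \<in> Z"
      then have "finite S" "S \<noteq> {}" using that by (auto simp: configs_def)
      then show "cmod (f (push_top s 0 S)) = cmod (f S)" by simp
    qed
    then show ?thesis unfolding True by (intro exI[of _ 0]) (simp add: lin_def)
  next
    case False
    obtain j u where u: "v = u + axis j (s $ j)" "\<And>j. s $ j * u $ j \<ge> 0" "lin m u \<ge> 0"
      using monotone_predecessor[OF s less.prems False] by blast
    have u0: "height s u \<ge> 0" unfolding height_def by (intro sum_nonneg u(2))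
    have hv: "height s v = height s u + 1" using u(1) s[of j] by auto
    have "\<exists>K\<ge>0. \<forall>f\<in>fin_vecs ?D. \<forall>Z. finite Z \<longrightarrow> Z \<subseteq> configs ?D - {{}} \<longrightarrow>
      exp (lin ?b u) * L2_set (\<lambda>S. cmod (f S)) Z
      \<le> L2_set (\<lambda>S. cmod (f (push_top s u S))) Z + K * sqrt (energy lam ?D f)"
      by (rule less.hyps) (use u u0 hv in auto)
    then obtain K where K0: "K \<ge> 0" and K: "\<forall>f\<in>fin_vecs ?D. \<forall>Z. finite Z \<longrightarrow> Z \<subseteq> configs ?D - {{}} \<longrightarrow>
      exp (lin ?b u) * L2_set (\<lambda>S. cmod (f S)) Z
      \<le> L2_set (\<lambda>S. cmod (f (push_top s u S))) Z + K * sqrt (energy lam ?D f)"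
      by (elim exE conjE)
    \<comment> \<open>The terms s_i u_i are nonnegative, so height zero forces all of them, and
      hence u, to vanish.\<close>
    have u_cases: "u = 0 \<or> height s u > 0"
    proof (rule ccontr)
      assume "\<not> ?thesis"
      then have "u \<noteq> 0" "height s u = 0" using u0 by auto
      from this(2) have "\<forall>i\<in>UNIV. s $ i * u $ i = 0"
        unfolding height_def by (subst (asm) sum_nonneg_eq_0_iff) (use u(2) in auto)
      then have su: "s $ i * u $ i = 0" for i by blast
      have "u $ i = 0" for i using su[of i] s[of i] by auto
      then show False using \<open>u \<noteq> 0\<close> by (simp add: vec_eq_iff)
    qed
    define r where "r = exp (ln (lam $ j) * s $ j)"
    define C where "C = (1 + 1 / lam $ j) * sqrt (1 + (lam $ j)^2)"
    have r: "r > 0" by (simp add: r_def)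
    have C: "C \<ge> 0" using lam[of j] by (simp add: C_def add_nonneg_nonneg)
    have exp_v: "exp (lin ?b v) = r * exp (lin ?b u)"
      unfolding u(1) lin_add lin_axis exp_add r_def by simp
    show ?thesis
    \<comment> \<open>The earlier error K is amplified by the factor r of the last step, and C is
      the error of that step itself.\<close>
    proof (intro exI[of _ "r * K + C"] conjI ballI allI impI)
      show "r * K + C \<ge> 0" using r C K0 by simp
      fix f Z assume f: "f \<in> fin_vecs ?D" and Z: "finite Z" "Z \<subseteq> configs ?D - {{}}"
      let ?E = "sqrt (energy lam ?D f)"
      have "exp (lin ?b v) * L2_set (\<lambda>S. cmod (f S)) Z
          = r * (exp (lin ?b u) * L2_set (\<lambda>S. cmod (f S)) Z)" by (simp add: exp_v)
      also have "\<dots> \<le> r * (L2_set (\<lambda>S. cmod (f (push_top s u S))) Z + K * ?E)"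
        by (rule mult_left_mono[OF K[rule_format, OF f Z]]) (use r in simp)
      also have "\<dots> = r * L2_set (\<lambda>S. cmod (f (push_top s u S))) Z + r * K * ?E"
        by (simp add: algebra_simps)
      also have "r * L2_set (\<lambda>S. cmod (f (push_top s u S))) Z
          \<le> L2_set (\<lambda>S. cmod (f (push_top s v S))) Z + C * ?E"
        unfolding r_def C_def u(1)
        by (rule push_top_step[OF f Z lam s u_cases])
          (use halfspace_add u less.prems(2) in auto)
      finally show "exp (lin ?b v) * L2_set (\<lambda>S. cmod (f S)) Z
          \<le> L2_set (\<lambda>S. cmod (f (push_top s v S))) Z + (r * K + C) * ?E"
        by (simp add: algebra_simps)
    qed
  qed
qed

text \<open>Rounding coordinate j moves it by less than 1 and so costs at most |c_j|, independently
  of t; for large t the linear term wins.\<close>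

lemma lin_floor_ge:
  "lin c (\<chi> j. \<lfloor>t * u $ j\<rfloor>) \<ge> t * (c \<bullet> u) - (\<Sum>j\<in>UNIV. \<bar>c $ j\<bar>)"
proof -
  have "t * (c $ j * u $ j) - \<bar>c $ j\<bar> \<le> c $ j * real_of_int \<lfloor>t * u $ j\<rfloor>" for j
  proof -
    have "\<bar>c $ j * (t * u $ j - real_of_int \<lfloor>t * u $ j\<rfloor>)\<bar> \<le> \<bar>c $ j\<bar> * 1"
      unfolding abs_mult by (rule mult_left_mono) (linarith, simp)
    then show ?thesis by (simp add: algebra_simps)
  qed
  then have "(\<Sum>j\<in>UNIV. t * (c $ j * u $ j) - \<bar>c $ j\<bar>) \<le> lin c (\<chi> j. \<lfloor>t * u $ j\<rfloor>)"
    unfolding lin_def by (intro sum_mono) simp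
  then show ?thesis by (simp add: inner_vec_def sum_subtractf sum_distrib_left)
qed

text \<open>The vector b + |b| m bisects b and m, so it has positive inner product with both unless
  b is a nonpositive multiple of m.\<close>
lemma exists_common_direction:
  fixes b m :: "real^'d"
  assumes m: "norm m = 1" and b: "b \<noteq> - (norm b) *\<^sub>R m"
  obtains v :: "int^'d" where "lin b v > 0" "lin m v > 0"
proof -
  define u where "u = b + norm b *\<^sub>R m"
  have mm: "m \<bullet> m = 1" using m by (simp add: dot_square_norm)
  have bb: "b \<bullet> b = norm b * norm b" by (simp add: dot_square_norm power2_eq_square)
  \<comment> \<open>b = 0 is excluded because it satisfies b = -|b| m.\<close>
  have b0: "norm b > 0" using b by auto
  have "u \<noteq> 0" using b by (auto simp: u_def add_eq_0_iff2)
  then have "u \<bullet> u > 0" by simp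
  \<comment> \<open>Expanding |u|^2 > 0 gives the strict inequality |b| + b.m > 0, on which both
    inner products with u depend.\<close>
  also have "u \<bullet> u = 2 * (norm b * (norm b + b \<bullet> m))"
    by (simp add: u_def inner_add_left inner_add_right mm bb inner_commute algebra_simps)
  finally have pos: "norm b + b \<bullet> m > 0" using b0 by (simp add: zero_less_mult_iff)
  have bu: "b \<bullet> u = norm b * (norm b + b \<bullet> m)" by (simp add: u_def inner_add_right bb algebra_simps)
  have mu: "m \<bullet> u = norm b + b \<bullet> m" by (simp add: u_def inner_add_right mm inner_commute)
  have pu: "b \<bullet> u > 0" "m \<bullet> u > 0" using pos b0 unfolding bu mu by simp_all
  \<comment> \<open>\<open>B c\<close> is the scale beyond which the rounding error no longer spoils
    positivity of \<open>lin c\<close>; t exceeds this threshold for both b and m.\<close>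
  define B where "B c = (\<Sum>j\<in>UNIV. \<bar>c $ j\<bar>) / (c \<bullet> u)" for c :: "real^'d"
  define t where "t = max (B b) (B m) + 1"
  have large: "lin c (\<chi> j. \<lfloor>t * u $ j\<rfloor>) > 0" if "c \<bullet> u > 0" "B c < t" for c
  proof -
    have "(\<Sum>j\<in>UNIV. \<bar>c $ j\<bar>) < t * (c \<bullet> u)" using that by (simp add: B_def pos_divide_less_eq)
    with lin_floor_ge[of t c u] show ?thesis by linarith
  qed
  show ?thesis
    by (rule that; rule large) (use pu in \<open>auto simp: t_def\<close>)
qed

text \<open>The displacement is injective on nonempty configurations, so composing with it cannot
  increase the norm of f, while it amplifies by w = exp(b.v) > 1 up to the energy. Comparing the two
  gives (w - 1)|f| \<le> K sqrt(E).\<close>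

lemma energy_gap:
  fixes lam m :: "real^'d"
  assumes lam: "\<And>j. lam $ j > 0" and m: "norm m = 1"
    and b: "(\<chi> j. ln (lam $ j)) \<noteq> - (norm (\<chi> j. ln (lam $ j))) *\<^sub>R m"
  obtains \<gamma> where "\<gamma> > 0"
    "\<And>f. f \<in> fin_vecs (halfspace m) \<Longrightarrow>
      \<gamma> * (\<Sum>S\<in>{S. f S \<noteq> 0} - {{}}. (cmod (f S))^2) \<le> energy lam (halfspace m) f"
proof -
  let ?D = "halfspace m" and ?b = "(\<chi> j. ln (lam $ j)) :: real^'d"
  obtain v where v: "lin ?b v > 0" "lin m v > 0" using exists_common_direction[OF m b] .
  \<comment> \<open>Coordinates with v_j = 0 get sign 1, so that s has no zero entries.\<close>
  define s :: "int^'d" where "s = (\<chi> j. if v $ j < 0 then - 1 else 1)"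
  have s: "s $ j = 1 \<or> s $ j = - 1" "s $ j * v $ j \<ge> 0" for j by (auto simp: s_def)
  obtain K where K0: "K \<ge> 0" and K: "\<forall>f\<in>fin_vecs ?D. \<forall>Z. finite Z \<longrightarrow> Z \<subseteq> configs ?D - {{}} \<longrightarrow>
    exp (lin ?b v) * L2_set (\<lambda>S. cmod (f S)) Z
    \<le> L2_set (\<lambda>S. cmod (f (push_top s v S))) Z + K * sqrt (energy lam ?D f)"
    using push_top_lower_bound[OF lam s less_imp_le[OF v(2)]] by (elim exE conjE)
  define w where "w = exp (lin ?b v)"
  have w: "w > 1" using v(1) by (simp add: w_def)
  have hv: "v = 0 \<or> height s v > 0"
  proof (rule disjCI)
    assume "\<not> height s v > 0"
    moreover have "height s v \<ge> 0" unfolding height_def by (intro sum_nonneg s(2))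
    ultimately have "height s v = 0" by linarith
    then have "\<forall>i\<in>UNIV. s $ i * v $ i = 0"
      unfolding height_def by (subst (asm) sum_nonneg_eq_0_iff) (use s(2) in auto)
    then have sv: "s $ i * v $ i = 0" for i by blast
    have "v $ i = 0" for i using sv[of i] s(1)[of i] by auto
    then show "v = 0" by (simp add: vec_eq_iff)
  qed
  show ?thesis
  proof
    \<comment> \<open>K + 1 replaces K because K may be 0.\<close>
    show "((w - 1) / (K + 1))^2 > 0" using w K0 by (simp add: zero_less_power)
    fix f assume f: "f \<in> fin_vecs ?D"
    define Z where "Z = {S. f S \<noteq> 0} - {{}}"
    let ?E = "energy lam ?D f"
    let ?T = "push_top s v"
    have E: "?E \<ge> 0" by (rule energy_nonneg[OF f])
    have Z: "finite Z" "Z \<subseteq> configs ?D - {{}}" using f by (auto simp: Z_def fin_vecs_def)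
    have inj: "inj_on ?T Z"
      by (rule inj_on_subset[OF inj_on_push_top[OF hv]]) (use Z(2) in \<open>auto simp: configs_def\<close>)
    have "(\<Sum>S\<in>Z. (cmod (f (?T S)))^2) = (\<Sum>S\<in>?T ` Z. (cmod (f S))^2)"
      by (simp only: sum.reindex[OF inj] comp_def)
    also have "\<dots> = (\<Sum>S\<in>?T ` Z \<inter> Z. (cmod (f S))^2)"
    proof (rule sum.mono_neutral_right)
      \<comment> \<open>A pushed configuration is never empty, so outside Z it lies outside the
        support of f.\<close>
      show "\<forall>S\<in>?T ` Z - ?T ` Z \<inter> Z. (cmod (f S))^2 = 0"
        by (auto simp: Z_def push_top_def)
    qed (use Z in auto)
    also have "\<dots> \<le> (\<Sum>S\<in>Z. (cmod (f S))^2)"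
      by (rule sum_mono2) (use Z in auto)
    finally have "L2_set (\<lambda>S. cmod (f (?T S))) Z \<le> L2_set (\<lambda>S. cmod (f S)) Z"
      unfolding L2_set_def by (rule real_sqrt_le_mono)
    moreover have "w * L2_set (\<lambda>S. cmod (f S)) Z \<le> L2_set (\<lambda>S. cmod (f (?T S))) Z + K * sqrt ?E"
      using K f Z unfolding w_def by blast
    moreover have "K * sqrt ?E \<le> (K + 1) * sqrt ?E" using E by (intro mult_right_mono) auto
    ultimately have "w * L2_set (\<lambda>S. cmod (f S)) Z - 1 * L2_set (\<lambda>S. cmod (f S)) Z \<le> (K + 1) * sqrt ?E"
      by linarith
    then have "(w - 1) * L2_set (\<lambda>S. cmod (f S)) Z \<le> (K + 1) * sqrt ?E"
      by (simp only: left_diff_distrib)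
    then have "(w - 1) / (K + 1) * L2_set (\<lambda>S. cmod (f S)) Z \<le> sqrt ?E"
      using K0 by (simp add: pos_divide_le_eq mult.commute)
    then have "((w - 1) / (K + 1) * L2_set (\<lambda>S. cmod (f S)) Z)^2 \<le> (sqrt ?E)^2"
      by (rule power_mono) (use w K0 in \<open>auto intro!: mult_nonneg_nonneg\<close>)
    then show "((w - 1) / (K + 1))^2 * (\<Sum>S\<in>{S. f S \<noteq> 0} - {{}}. (cmod (f S))^2) \<le> ?E"
      using E unfolding Z_def[symmetric] by (simp only: power_mult_distrib L2_set_def real_sqrt_pow2 sum_nonneg zero_le_power2)
  qed
qed

section \<open>The resolvent below the gap\<close>

lemma fin_vecs_square_summable: "f \<in> fin_vecs D \<Longrightarrow> square_summable f"
  by (rule l2norm_finite_support(1)[of "{S. f S \<noteq> 0}"]) (auto simp: fin_vecs_def)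

lemma l2norm_power2:
  assumes "finite F" "\<And>S. f S \<noteq> 0 \<Longrightarrow> S \<in> F"
  shows "(l2norm f)^2 = (\<Sum>S\<in>F. (cmod (f S))^2)"
proof -
  have "l2norm f = L2_set (\<lambda>S. cmod (f S)) F"
    by (rule l2norm_finite_support(2)) (use assms in auto)
  then show ?thesis by (simp add: L2_set_def sum_nonneg)
qed

lemma l2_iff: "f \<in> l2 D \<longleftrightarrow> (\<forall>S. S \<notin> configs D \<longrightarrow> f S = 0) \<and> square_summable f"
  by (simp add: l2_def square_summable_def)

lemma l2_linear:
  assumes "f \<in> l2 D" "g \<in> l2 D"
  shows "(\<lambda>S. a * f S + b * g S) \<in> l2 D"
  using assms l2norm_sum_le(1)[OF square_summable_scale square_summable_scale, of f g a b]
  by (simp add: l2_iff)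

section \<open>The sign flip of the vacuum and the shifted Hamiltonian on finite-particle
  vectors\<close>

definition flip_vacuum :: "((int^'d) set \<Rightarrow> complex) \<Rightarrow> (int^'d) set \<Rightarrow> complex" where
  "flip_vacuum f S = (if S = {} then - f S else f S)"

lemma norm_flip_vacuum [simp]: "cmod (flip_vacuum f S) = cmod (f S)"
  by (simp add: flip_vacuum_def)

lemma flip_vacuum_eq_0 [simp]: "flip_vacuum f S = 0 \<longleftrightarrow> f S = 0"
  by (simp add: flip_vacuum_def)

lemma l2norm_flip_vacuum [simp]: "l2norm (flip_vacuum f) = l2norm f"
  by (simp add: l2norm_def)

definition shifted :: "real^'d \<Rightarrow> (int^'d) set \<Rightarrow> real \<Rightarrow> ((int^'d) set \<Rightarrow> complex) \<Rightarrow> (int^'d) set \<Rightarrow> complex" where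
  "shifted lam D \<mu> f S = H0 lam D f S - of_real \<mu> * f S"

lemma shifted_fin_vecs:
  assumes "f \<in> fin_vecs D"
  shows "shifted lam D \<mu> f \<in> fin_vecs D"
  using fin_vecs_linear[OF H0_fin_vecs[OF assms] assms, of 1 lam "- of_real \<mu>"]
  by (simp add: shifted_def[abs_def])

lemma shifted_linear:
  assumes "f \<in> fin_vecs D" "g \<in> fin_vecs D"
  shows "shifted lam D \<mu> (\<lambda>S. a * f S + b * g S) S = a * shifted lam D \<mu> f S + b * shifted lam D \<mu> g S"
  unfolding shifted_def H0_linear[OF assms] by (simp add: algebra_simps)

text \<open>The iteration takes place in this space: it is stable under H - mu and the vacuum flip,
  and H is bounded on it with a constant depending only on n and the dimension.\<close>

definition bounded_vecs :: "(int^'d) set \<Rightarrow> nat \<Rightarrow> ((int^'d) set \<Rightarrow> complex) set" where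
  "bounded_vecs D n = {f \<in> fin_vecs D. \<forall>S. f S \<noteq> 0 \<longrightarrow> card S \<le> n}"

lemma bounded_vecs_linear:
  assumes "f \<in> bounded_vecs D n" "g \<in> bounded_vecs D n"
  shows "(\<lambda>S. a * f S + b * g S) \<in> bounded_vecs D n"
proof -
  have "card S \<le> n" if "a * f S + b * g S \<noteq> 0" for S
  proof -
    have "f S \<noteq> 0 \<or> g S \<noteq> 0" using that by auto
    then show ?thesis using assms by (auto simp: bounded_vecs_def)
  qed
  then show ?thesis using assms fin_vecs_linear[of f D g a b] by (simp add: bounded_vecs_def)
qed

lemma bounded_vecs_flip_vacuum:
  "f \<in> bounded_vecs D n \<Longrightarrow> flip_vacuum f \<in> bounded_vecs D n"
  by (simp add: bounded_vecs_def fin_vecs_def)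

lemma bounded_vecs_shifted:
  assumes "f \<in> bounded_vecs D n"
  shows "shifted lam D \<mu> f \<in> bounded_vecs D n"
proof -
  have f: "f \<in> fin_vecs D" "\<And>S. f S \<noteq> 0 \<Longrightarrow> card S \<le> n" using assms by (auto simp: bounded_vecs_def)
  have "card S \<le> n" if "shifted lam D \<mu> f S \<noteq> 0" for S
  proof (cases "f S = 0")
    case True
    then have "H0 lam D f S \<noteq> 0" using that by (simp add: shifted_def)
    from H0_card_le[OF f this] show ?thesis .
  qed (rule f(2))
  then show ?thesis using shifted_fin_vecs[OF f(1)] by (simp add: bounded_vecs_def)
qed

lemma fin_vecs_bounded:
  assumes "f \<in> fin_vecs D"
  obtains n where "f \<in> bounded_vecs D n"
proof
  have fin: "finite {S. f S \<noteq> 0}" using assms by (simp add: fin_vecs_def)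
  \<comment> \<open>For f = 0 the maximum is taken over the empty set, which is harmless because the
    bound is then vacuous.\<close>
  show "f \<in> bounded_vecs D (Max (card ` {S. f S \<noteq> 0}))"
    using assms fin by (auto simp: bounded_vecs_def intro!: Max_ge)
qed

lemma l2norm_shifted_le:
  fixes f :: "(int^'d) set \<Rightarrow> complex"
  assumes "f \<in> bounded_vecs D n" "\<mu> \<ge> 0"
  shows "l2norm (shifted lam D \<mu> f) \<le> (real (4 * CARD('d) * n) + \<mu>) * l2norm f"
proof -
  let ?M = "real (4 * CARD('d) * n)"
  have f: "f \<in> fin_vecs D" "\<And>S. f S \<noteq> 0 \<Longrightarrow> card S \<le> n" using assms by (auto simp: bounded_vecs_def)
  have Hf: "H0 lam D f \<in> fin_vecs D" by (rule H0_fin_vecs[OF f(1)])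
  have "(l2norm (H0 lam D f))^2 = (\<Sum>S | H0 lam D f S \<noteq> 0. (cmod (H0 lam D f S))^2)"
    by (rule l2norm_power2) (use Hf in \<open>auto simp: fin_vecs_def\<close>)
  also have "\<dots> \<le> ?M^2 * (\<Sum>S | f S \<noteq> 0. (cmod (f S))^2)"
    by (rule H0_bounded[OF f]) (use f(1) Hf in \<open>auto simp: fin_vecs_def\<close>)
  also have "(\<Sum>S | f S \<noteq> 0. (cmod (f S))^2) = (l2norm f)^2"
    by (rule l2norm_power2[symmetric]) (use f(1) in \<open>auto simp: fin_vecs_def\<close>)
  finally have "(l2norm (H0 lam D f))^2 \<le> (?M * l2norm f)^2" by (simp only: power_mult_distrib)
  then have H: "l2norm (H0 lam D f) \<le> ?M * l2norm f" by (rule power2_le_imp_le) simp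
  have "l2norm (shifted lam D \<mu> f) \<le> l2norm (H0 lam D f) + l2norm (\<lambda>S. of_real \<mu> * f S)"
    unfolding shifted_def[abs_def]
    by (intro l2norm_diff_le square_summable_scale fin_vecs_square_summable[OF Hf] fin_vecs_square_summable[OF f(1)])
  also have "l2norm (\<lambda>S. of_real \<mu> * f S) = \<mu> * l2norm f"
    using assms(2) by (simp add: l2norm_scale)
  finally show ?thesis using H by (simp only: distrib_right)
qed

section \<open>Coercivity and dense range for mu inside the gap\<close>

locale gapped =
  fixes lam :: "real^'d" and D :: "(int^'d) set" and \<gamma> \<mu> :: real
  assumes gap: "f \<in> fin_vecs D \<Longrightarrow>
      \<gamma> * (\<Sum>S\<in>{S. f S \<noteq> 0} - {{}}. (cmod (f S))^2) \<le> energy lam D f"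
    and mu: "0 < \<mu>" "\<mu> < \<gamma>"
begin

text \<open>The coercivity constant: the flipped form is mu on the vacuum and at least gamma - mu
  off it.\<close>

definition c :: real where "c = min \<mu> (\<gamma> - \<mu>)"

lemma c_pos: "c > 0" using mu by (simp add: c_def)

abbreviation sh :: "((int^'d) set \<Rightarrow> complex) \<Rightarrow> (int^'d) set \<Rightarrow> complex" where
  "sh \<equiv> shifted lam D \<mu>"

text \<open>H - mu is negative on the vacuum and positive on its complement; flipping the sign of the
  vacuum component makes it coercive on the whole space.\<close>
lemma flip_shifted_coercive:
  assumes f: "f \<in> fin_vecs D" and F: "finite F" "\<And>S. f S \<noteq> 0 \<Longrightarrow> S \<in> F"
  shows "c * (l2norm f)^2 \<le> (\<Sum>S\<in>F. Re (cnj (f S) * flip_vacuum (sh f) S))"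
proof -
  let ?N = "{S. f S \<noteq> 0}"
  let ?w = "\<lambda>S::(int^'d) set. if S = {} then \<mu> else - \<mu>"
  have N: "finite ?N" using f by (simp add: fin_vecs_def)
  have term_eq: "Re (cnj (f S) * flip_vacuum (sh f) S) = Re (cnj (f S) * H0 lam D f S) + ?w S * (cmod (f S))^2" for S
    unfolding cmod_power2
    by (simp add: flip_vacuum_def shifted_def H0_empty algebra_simps power2_eq_square)
  have "(\<Sum>S\<in>F. Re (cnj (f S) * flip_vacuum (sh f) S)) = (\<Sum>S\<in>?N. Re (cnj (f S) * flip_vacuum (sh f) S))"
  proof (rule sum.mono_neutral_right)
    show "\<forall>S\<in>F - ?N. Re (cnj (f S) * flip_vacuum (sh f) S) = 0" by simp
  qed (use F in auto)
  also have "\<dots> = energy lam D f + (\<Sum>S\<in>?N. ?w S * (cmod (f S))^2)"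
    unfolding term_eq sum.distrib energy_def ..
  also have "\<dots> \<ge> \<gamma> * (\<Sum>S\<in>?N - {{}}. (cmod (f S))^2) + (\<Sum>S\<in>?N. ?w S * (cmod (f S))^2)"
    using gap[OF f] by simp
  also have "(\<Sum>S\<in>?N - {{}}. (cmod (f S))^2) = (\<Sum>S\<in>?N. (if S = {} then 0 else 1) * (cmod (f S))^2)"
    by (rule sum.mono_neutral_cong_left) (use N in auto)
  also have "\<gamma> * \<dots> + (\<Sum>S\<in>?N. ?w S * (cmod (f S))^2)
      = (\<Sum>S\<in>?N. (if S = {} then \<mu> else \<gamma> - \<mu>) * (cmod (f S))^2)"
    unfolding sum_distrib_left sum.distrib[symmetric] by (intro sum.cong refl) (simp add: algebra_simps)
  also have "\<dots> \<ge> (\<Sum>S\<in>?N. c * (cmod (f S))^2)"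
    by (intro sum_mono mult_right_mono) (auto simp: c_def)
  also have "(\<Sum>S\<in>?N. c * (cmod (f S))^2) = c * (l2norm f)^2"
    unfolding sum_distrib_left[symmetric] using l2norm_power2[OF N, of f] by simp
  finally show ?thesis .
qed

text \<open>Cauchy-Schwarz applied to the coercive form; the flip leaves moduli unchanged, so the
  bound holds for H - mu itself.\<close>

lemma shifted_lower_bound:
  assumes f: "f \<in> fin_vecs D"
  shows "c * l2norm f \<le> l2norm (sh f)"
proof -
  let ?N = "{S. f S \<noteq> 0}"
  have N: "finite ?N" using f by (simp add: fin_vecs_def)
  have ss: "square_summable (sh f)" by (rule fin_vecs_square_summable[OF shifted_fin_vecs[OF f]])
  have "c * (l2norm f)^2 \<le> (\<Sum>S\<in>?N. Re (cnj (f S) * flip_vacuum (sh f) S))"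
    by (rule flip_shifted_coercive[OF f N]) simp
  also have "\<dots> \<le> (\<Sum>S\<in>?N. \<bar>cmod (f S)\<bar> * \<bar>cmod (sh f S)\<bar>)"
  proof (rule sum_mono)
    fix S
    show "Re (cnj (f S) * flip_vacuum (sh f) S) \<le> \<bar>cmod (f S)\<bar> * \<bar>cmod (sh f S)\<bar>"
      using complex_Re_le_cmod[of "cnj (f S) * flip_vacuum (sh f) S"]
      by (simp only: norm_mult complex_mod_cnj norm_flip_vacuum abs_norm_cancel)
  qed
  also have "\<dots> \<le> L2_set (\<lambda>S. cmod (f S)) ?N * L2_set (\<lambda>S. cmod (sh f S)) ?N"
    by (rule L2_set_mult_ineq)
  also have "\<dots> \<le> l2norm f * l2norm (sh f)"
    by (intro mult_mono L2_set_le_l2norm fin_vecs_square_summable[OF f] ss N) simp_all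
  finally have *: "l2norm f * (c * l2norm f) \<le> l2norm f * l2norm (sh f)"
    by (simp add: power2_eq_square algebra_simps)
  show ?thesis
  proof (cases "l2norm f = 0")
    case False
    then have "l2norm f > 0" using l2norm_nonneg[of f] by linarith
    with * show ?thesis by (simp only: mult_le_cancel_left_pos)
  qed simp
qed

text \<open>With A the flipped operator, |r - tAr|^2 is at most (1 - 2tc + t^2 M^2)|r|^2 by
  coercivity and boundedness. The choice t = c / M^2 minimises this factor.\<close>

lemma richardson_step:
  fixes n
  defines "M \<equiv> real (4 * CARD('d) * n) + \<mu> + c"
  assumes r: "r \<in> bounded_vecs D n"
  shows "(l2norm (\<lambda>S. r S - of_real (c / M^2) * flip_vacuum (sh r) S))^2 \<le> (1 - c^2 / M^2) * (l2norm r)^2"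
proof -
  let ?A = "flip_vacuum (sh r)" and ?t = "c / M^2"
  have M: "M > 0" using mu c_pos by (simp add: M_def add_nonneg_pos)
  have rf: "r \<in> fin_vecs D" using r by (simp add: bounded_vecs_def)
  define F where "F = {S. r S \<noteq> 0} \<union> {S. sh r S \<noteq> 0}"
  have F: "finite F" "\<And>S. r S \<noteq> 0 \<Longrightarrow> S \<in> F" "\<And>S. ?A S \<noteq> 0 \<Longrightarrow> S \<in> F"
    using rf shifted_fin_vecs[OF rf, of lam \<mu>] by (auto simp: F_def fin_vecs_def)
  have sq: "(cmod (a - of_real k * b))^2 = (cmod a)^2 - 2 * k * Re (cnj a * b) + k^2 * (cmod b)^2" for a b k
    unfolding cmod_power2 by (simp add: power2_eq_square algebra_simps)
  have t: "?t \<ge> 0" using c_pos by simp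
  have "(l2norm (\<lambda>S. r S - of_real ?t * ?A S))^2 = (\<Sum>S\<in>F. (cmod (r S - of_real ?t * ?A S))^2)"
  proof (rule l2norm_power2[OF F(1)])
    fix S assume "r S - of_real ?t * ?A S \<noteq> 0"
    then have "r S \<noteq> 0 \<or> ?A S \<noteq> 0" by auto
    then show "S \<in> F" using F by blast
  qed
  also have "\<dots> = (\<Sum>S\<in>F. (cmod (r S))^2) - 2 * ?t * (\<Sum>S\<in>F. Re (cnj (r S) * ?A S)) + ?t^2 * (\<Sum>S\<in>F. (cmod (?A S))^2)"
    unfolding sq sum.distrib sum_subtractf sum_distrib_left ..
  also have "\<dots> = (l2norm r)^2 - 2 * ?t * (\<Sum>S\<in>F. Re (cnj (r S) * ?A S)) + ?t^2 * (l2norm ?A)^2"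
  proof -
    have "(l2norm r)^2 = (\<Sum>S\<in>F. (cmod (r S))^2)" by (rule l2norm_power2[OF F(1)]) (rule F(2))
    moreover have "(l2norm ?A)^2 = (\<Sum>S\<in>F. (cmod (?A S))^2)" by (rule l2norm_power2[OF F(1)]) (rule F(3))
    ultimately show ?thesis by (simp only:)
  qed
  also have "\<dots> \<le> (l2norm r)^2 - 2 * ?t * (c * (l2norm r)^2) + ?t^2 * (M * l2norm r)^2"
  proof (intro add_mono diff_mono mult_left_mono power_mono order_refl)
    show "c * (l2norm r)^2 \<le> (\<Sum>S\<in>F. Re (cnj (r S) * ?A S))"
      by (rule flip_shifted_coercive[OF rf F(1,2)])
    have "l2norm (sh r) \<le> (real (4 * CARD('d) * n) + \<mu>) * l2norm r"
      by (rule l2norm_shifted_le[OF r]) (use mu in simp)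
    also have "\<dots> \<le> M * l2norm r" using c_pos by (intro mult_right_mono) (simp_all add: M_def)
    finally show "l2norm ?A \<le> M * l2norm r" by simp
  qed (use t in simp_all)
  also have "\<dots> = (1 - c^2 / M^2) * (l2norm r)^2"
    using M by (simp add: field_simps power2_eq_square)
  finally show ?thesis .
qed

text \<open>Richardson iteration for A f = p: adding t times the residual to f contracts the squared
  residual by q. The iterates stay at particle bound n, so one M serves all steps.\<close>

lemma flip_shifted_dense_range:
  assumes p: "p \<in> bounded_vecs D n" and e: "e > 0"
  obtains f where "f \<in> bounded_vecs D n" "l2norm (\<lambda>S. p S - flip_vacuum (sh f) S) < e"
proof -
  define M where "M = real (4 * CARD('d) * n) + \<mu> + c"
  define q where "q = 1 - c^2 / M^2"
  have M: "M > 0" "M \<ge> c" using mu c_pos by (simp_all add: M_def add_nonneg_pos)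
  \<comment> \<open>The summand c in M ensures M \<ge> c, hence a nonnegative contraction
    factor.\<close>
  have "c^2 \<le> M^2" using M c_pos by (intro power_mono) simp_all
  then have q: "0 \<le> q" "q < 1" using M c_pos by (simp_all add: q_def divide_le_eq)
  have step: "\<exists>f\<in>bounded_vecs D n. (l2norm (\<lambda>S. p S - flip_vacuum (sh f) S))^2 \<le> q^k * (l2norm p)^2" for k
  proof (induction k)
    case 0
    have 0: "(\<lambda>S. 0) \<in> bounded_vecs D n" by (simp add: bounded_vecs_def fin_vecs_def)
    have "0 * sh (\<lambda>S. 0) S + 0 * sh (\<lambda>S. 0) S = sh (\<lambda>S. 0) S" for S
      using shifted_linear[of "\<lambda>S. 0" D "\<lambda>S. 0" lam \<mu> 0 0 S] 0 by (simp add: bounded_vecs_def)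
    then have "sh (\<lambda>S. 0) S = 0" for S by simp
    then have "(\<lambda>S. p S - flip_vacuum (sh (\<lambda>S. 0)) S) = p"
      by (auto simp: flip_vacuum_def)
    then show ?case using 0 by (intro bexI[of _ "\<lambda>S. 0"]) simp_all
  next
    case (Suc k)
    then obtain f where f: "f \<in> bounded_vecs D n"
      and le: "(l2norm (\<lambda>S. p S - flip_vacuum (sh f) S))^2 \<le> q^k * (l2norm p)^2" by blast
    define r where "r = (\<lambda>S. p S - flip_vacuum (sh f) S)"
    have r: "r \<in> bounded_vecs D n"
      using bounded_vecs_linear[OF p bounded_vecs_flip_vacuum[OF bounded_vecs_shifted[OF f]], of 1 "-1" lam \<mu>]
      by (simp add: r_def)
    define t where "t = complex_of_real (c / M^2)"
    define f' where "f' = (\<lambda>S. 1 * f S + t * r S)"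
    have f': "f' \<in> bounded_vecs D n" unfolding f'_def by (rule bounded_vecs_linear[OF f r])
    have ff: "f \<in> fin_vecs D" "r \<in> fin_vecs D" using f r by (simp_all add: bounded_vecs_def)
    have "sh f' S = 1 * sh f S + t * sh r S" for S
      unfolding f'_def by (rule shifted_linear[OF ff])
    \<comment> \<open>By linearity the new residual is r - tAr, the form treated by
      \<open>richardson_step\<close>.\<close>
    then have "p S - flip_vacuum (sh f') S = r S - t * flip_vacuum (sh r) S" for S
      by (simp add: flip_vacuum_def r_def)
    then have "(l2norm (\<lambda>S. p S - flip_vacuum (sh f') S))^2 \<le> q * (l2norm r)^2"
      using richardson_step[OF r] by (simp add: t_def M_def q_def)
    also have "\<dots> \<le> q * (q^k * (l2norm p)^2)"
      by (rule mult_left_mono) (use le q in \<open>simp_all add: r_def\<close>)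
    finally show ?case using f' by (intro bexI[of _ f']) simp_all
  qed
  have "(\<lambda>k. q^k * (l2norm p)^2) \<longlonglongrightarrow> 0 * (l2norm p)^2"
    by (intro tendsto_mult LIMSEQ_realpow_zero q tendsto_const)
  then have "\<forall>\<^sub>F k in sequentially. q^k * (l2norm p)^2 < e^2"
    by (rule order_tendstoD) (use e in simp)
  then obtain k where k: "q^k * (l2norm p)^2 < e^2" by (meson eventually_sequentially order_refl)
  from step[of k] obtain f where f: "f \<in> bounded_vecs D n"
    and le: "(l2norm (\<lambda>S. p S - flip_vacuum (sh f) S))^2 \<le> q^k * (l2norm p)^2" by blast
  have "(l2norm (\<lambda>S. p S - flip_vacuum (sh f) S))^2 < e^2" using le k by linarith
  then have "l2norm (\<lambda>S. p S - flip_vacuum (sh f) S) < e"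
    by (rule power2_less_imp_less) (use e in simp)
  with f show ?thesis by (rule that)
qed

text \<open>Truncation makes p finitely supported, hence of bounded particle number. Solving for the
  flipped truncation and undoing the norm-preserving flip removes the flip from the
  operator.\<close>

lemma shifted_dense_range:
  assumes p: "p \<in> l2 D" and e: "e > 0"
  obtains f where "f \<in> fin_vecs D" "l2norm (\<lambda>S. sh f S - p S) < e"
proof -
  have ps: "square_summable p" "\<And>S. S \<notin> configs D \<Longrightarrow> p S = 0"
    using p by (auto simp: l2_def square_summable_def)
  obtain F where F: "finite F" "l2norm (\<lambda>S. p S - (if S \<in> F then p S else 0)) < e / 2"
    using l2_truncation[OF ps(1), of "e/2"] e by auto
  define q where "q = (\<lambda>S. if S \<in> F then p S else 0)"
  have q: "q \<in> fin_vecs D"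
    using ps(2) F(1) by (auto simp: q_def fin_vecs_def intro: finite_subset[of _ F])
  obtain n where n: "q \<in> bounded_vecs D n" using fin_vecs_bounded[OF q] .
  obtain f where f: "f \<in> bounded_vecs D n" "l2norm (\<lambda>S. flip_vacuum q S - flip_vacuum (sh f) S) < e / 2"
    using flip_shifted_dense_range[OF bounded_vecs_flip_vacuum[OF n], of "e/2"] e by auto
  have ff: "f \<in> fin_vecs D" using f(1) by (simp add: bounded_vecs_def)
  have "(\<lambda>S. flip_vacuum q S - flip_vacuum (sh f) S) = flip_vacuum (\<lambda>S. q S - sh f S)"
    by (rule ext) (simp add: flip_vacuum_def)
  with f(2) have 1: "l2norm (\<lambda>S. sh f S - q S) < e / 2" by (simp add: l2norm_minus_commute)
  have 2: "l2norm (\<lambda>S. q S - p S) < e / 2" using F(2) by (simp add: q_def l2norm_minus_commute)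
  have "l2norm (\<lambda>S. sh f S - p S) \<le> l2norm (\<lambda>S. sh f S - q S) + l2norm (\<lambda>S. q S - p S)"
    by (intro l2norm_triangle_diff ps(1) fin_vecs_square_summable[OF q]
        fin_vecs_square_summable[OF shifted_fin_vecs[OF ff]])
  with 1 2 have "l2norm (\<lambda>S. sh f S - p S) < e" by linarith
  with ff show ?thesis by (rule that)
qed

section \<open>The closed graph and the resolvent\<close>

lemma graph_linear:
  assumes "(\<psi>1, \<eta>1) \<in> HD_graph lam D" "(\<psi>2, \<eta>2) \<in> HD_graph lam D"
  shows "(\<lambda>S. a * \<psi>1 S + b * \<psi>2 S, \<lambda>S. a * \<eta>1 S + b * \<eta>2 S) \<in> HD_graph lam D"
proof -
  let ?H = "H0 lam D"
  obtain f where f: "\<And>n. f n \<in> fin_vecs D" "(\<lambda>n. l2norm (\<lambda>S. f n S - \<psi>1 S)) \<longlonglongrightarrow> 0"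
    "(\<lambda>n. l2norm (\<lambda>S. ?H (f n) S - \<eta>1 S)) \<longlonglongrightarrow> 0"
    using assms(1) by (auto simp: HD_graph_def)
  obtain g where g: "\<And>n. g n \<in> fin_vecs D" "(\<lambda>n. l2norm (\<lambda>S. g n S - \<psi>2 S)) \<longlonglongrightarrow> 0"
    "(\<lambda>n. l2norm (\<lambda>S. ?H (g n) S - \<eta>2 S)) \<longlonglongrightarrow> 0"
    using assms(2) by (auto simp: HD_graph_def)
  have l2: "\<psi>1 \<in> l2 D" "\<eta>1 \<in> l2 D" "\<psi>2 \<in> l2 D" "\<eta>2 \<in> l2 D"
    using assms by (auto simp: HD_graph_def)
  have conv: "(\<lambda>n. l2norm (\<lambda>S. (a * u n S + b * v n S) - (a * x S + b * y S))) \<longlonglongrightarrow> 0"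
    if "(\<lambda>n. l2norm (\<lambda>S. u n S - x S)) \<longlonglongrightarrow> 0" "(\<lambda>n. l2norm (\<lambda>S. v n S - y S)) \<longlonglongrightarrow> 0"
      and "\<And>n. u n \<in> fin_vecs D" "\<And>n. v n \<in> fin_vecs D" "x \<in> l2 D" "y \<in> l2 D"
    for u v :: "nat \<Rightarrow> (int^'d) set \<Rightarrow> complex" and x y
  proof (rule real_tendsto_sandwich[OF _ _ tendsto_const])
    show "\<forall>\<^sub>F n in sequentially. 0 \<le> l2norm (\<lambda>S. (a * u n S + b * v n S) - (a * x S + b * y S))"
      by simp
    have "l2norm (\<lambda>S. (a * u n S + b * v n S) - (a * x S + b * y S))
        \<le> cmod a * l2norm (\<lambda>S. u n S - x S) + cmod b * l2norm (\<lambda>S. v n S - y S)" for n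
    proof -
      have "square_summable (\<lambda>S. u n S - x S)" "square_summable (\<lambda>S. v n S - y S)"
        using that(5,6) fin_vecs_square_summable[OF that(3)] fin_vecs_square_summable[OF that(4)]
        by (auto simp: l2_iff intro: square_summable_diff)
      from l2norm_sum_le(2)[OF this[THEN square_summable_scale], of a b]
      show ?thesis unfolding l2norm_scale by (simp add: algebra_simps)
    qed
    then show "\<forall>\<^sub>F n in sequentially. l2norm (\<lambda>S. (a * u n S + b * v n S) - (a * x S + b * y S))
        \<le> cmod a * l2norm (\<lambda>S. u n S - x S) + cmod b * l2norm (\<lambda>S. v n S - y S)"
      by simp
    have "(\<lambda>n. cmod a * l2norm (\<lambda>S. u n S - x S) + cmod b * l2norm (\<lambda>S. v n S - y S))
        \<longlonglongrightarrow> cmod a * 0 + cmod b * 0"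
      by (intro tendsto_intros that(1,2))
    then show "(\<lambda>n. cmod a * l2norm (\<lambda>S. u n S - x S) + cmod b * l2norm (\<lambda>S. v n S - y S)) \<longlonglongrightarrow> 0"
      by simp
  qed
  have H: "?H (\<lambda>S. a * f n S + b * g n S) = (\<lambda>S. a * ?H (f n) S + b * ?H (g n) S)" for n
    by (rule ext) (rule H0_linear[OF f(1) g(1)])
  have "(\<lambda>n. l2norm (\<lambda>S. ?H (\<lambda>S. a * f n S + b * g n S) S - (a * \<eta>1 S + b * \<eta>2 S))) \<longlonglongrightarrow> 0"
    unfolding H by (rule conv[OF f(3) g(3) H0_fin_vecs[OF f(1)] H0_fin_vecs[OF g(1)] l2(2,4)])
  moreover have "(\<lambda>n. l2norm (\<lambda>S. a * f n S + b * g n S - (a * \<psi>1 S + b * \<psi>2 S))) \<longlonglongrightarrow> 0"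
    by (rule conv[OF f(2) g(2) f(1) g(1) l2(1,3)])
  moreover have "\<forall>n. (\<lambda>S. a * f n S + b * g n S) \<in> fin_vecs D"
    using fin_vecs_linear[OF f(1) g(1)] by blast
  ultimately show ?thesis
    unfolding HD_graph_def mem_Collect_eq prod.case
    by (intro conjI l2_linear l2 exI[of _ "\<lambda>n S. a * f n S + b * g n S"])
qed

text \<open>The lower bound on finitely supported vectors survives the limits that define the
  closure.\<close>

lemma graph_lower_bound:
  assumes "(\<psi>, \<eta>) \<in> HD_graph lam D"
  shows "c * l2norm \<psi> \<le> l2norm (\<lambda>S. \<eta> S - of_real \<mu> * \<psi> S)"
proof -
  let ?H = "H0 lam D"
  obtain f where f: "\<And>n. f n \<in> fin_vecs D" "(\<lambda>n. l2norm (\<lambda>S. f n S - \<psi> S)) \<longlonglongrightarrow> 0"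
    "(\<lambda>n. l2norm (\<lambda>S. ?H (f n) S - \<eta> S)) \<longlonglongrightarrow> 0"
    using assms by (auto simp: HD_graph_def)
  have ss: "square_summable \<psi>" "square_summable \<eta>"
    using assms by (auto simp: HD_graph_def l2_iff)
  let ?z = "\<lambda>S. \<eta> S - of_real \<mu> * \<psi> S"
  \<comment> \<open>\<open>sh (f n)\<close> splits into the target z, the error of H f and mu times
    the error of f; the further c times the latter pays for replacing \<psi> by
    \<open>f n\<close>.\<close>
  let ?r = "\<lambda>n. l2norm ?z + l2norm (\<lambda>S. ?H (f n) S - \<eta> S) + (\<mu> + c) * l2norm (\<lambda>S. f n S - \<psi> S)"
  have z: "square_summable ?z" by (intro square_summable_diff square_summable_scale ss)
  have "c * l2norm \<psi> \<le> ?r n" for n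
  proof -
    have fs: "square_summable (f n)" "square_summable (?H (f n))"
      using f(1) H0_fin_vecs[OF f(1)] by (auto intro: fin_vecs_square_summable)
    have "l2norm \<psi> = l2norm (\<lambda>S. f n S - (f n S - \<psi> S))" by simp
    also have "\<dots> \<le> l2norm (f n) + l2norm (\<lambda>S. f n S - \<psi> S)"
      by (intro l2norm_diff_le square_summable_diff fs ss)
    finally have "c * l2norm \<psi> \<le> c * (l2norm (f n) + l2norm (\<lambda>S. f n S - \<psi> S))"
      by (rule mult_left_mono) (use c_pos in simp)
    also have "\<dots> = c * l2norm (f n) + c * l2norm (\<lambda>S. f n S - \<psi> S)" by (rule distrib_left)
    also have "c * l2norm (f n) \<le> l2norm (sh (f n))" by (rule shifted_lower_bound[OF f(1)])
    also have "sh (f n) = (\<lambda>S. (?z S + (?H (f n) S - \<eta> S)) - of_real \<mu> * (f n S - \<psi> S))"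
      by (rule ext) (simp add: shifted_def algebra_simps)
    also have "l2norm \<dots> \<le> l2norm (\<lambda>S. ?z S + (?H (f n) S - \<eta> S)) + l2norm (\<lambda>S. of_real \<mu> * (f n S - \<psi> S))"
      by (intro l2norm_diff_le l2norm_sum_le(1) square_summable_scale square_summable_diff fs ss)
    also have "l2norm (\<lambda>S. ?z S + (?H (f n) S - \<eta> S)) \<le> l2norm ?z + l2norm (\<lambda>S. ?H (f n) S - \<eta> S)"
      by (intro l2norm_sum_le(2) z square_summable_diff fs ss)
    also have "l2norm (\<lambda>S. of_real \<mu> * (f n S - \<psi> S)) = \<mu> * l2norm (\<lambda>S. f n S - \<psi> S)"
      using mu by (simp add: l2norm_scale)
    finally show ?thesis by (simp add: distrib_right)
  qed
  moreover have "?r \<longlonglongrightarrow> l2norm ?z + 0 + (\<mu> + c) * 0" by (intro tendsto_intros f(2,3))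
  ultimately show ?thesis
    using LIMSEQ_le_const[of ?r "l2norm ?z + 0 + (\<mu> + c) * 0" "c * l2norm \<psi>"] by simp
qed

text \<open>Approximate solutions exist by dense range, and the lower bound makes them Cauchy. H f_n
  then converges as well, so the limit lies in the closed graph.\<close>

lemma graph_solution:
  assumes p: "p \<in> l2 D"
  shows "\<exists>\<psi>. (\<psi>, \<lambda>S. p S + of_real \<mu> * \<psi> S) \<in> HD_graph lam D"
proof -
  let ?H = "H0 lam D"
  have ps: "square_summable p" using p by (simp add: l2_iff)
  have "\<exists>f. f \<in> fin_vecs D \<and> l2norm (\<lambda>S. sh f S - p S) < 1 / Suc n" for n
    using shifted_dense_range[OF p, of "1 / Suc n"] by auto
  then obtain f where f: "\<And>n. f n \<in> fin_vecs D" "\<And>n. l2norm (\<lambda>S. sh (f n) S - p S) < 1 / Suc n"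
    by metis
  have fs: "square_summable (f n)" "square_summable (sh (f n))" for n
    by (rule fin_vecs_square_summable[OF f(1)])
      (rule fin_vecs_square_summable[OF shifted_fin_vecs[OF f(1)]])
  have inv0: "(\<lambda>n. 1 / Suc n) \<longlonglongrightarrow> (0::real)" by (rule LIMSEQ_Suc[OF lim_1_over_n])
  have cau: "c * l2norm (\<lambda>S. f n S - f k S) \<le> 1 / Suc n + 1 / Suc k" for n k
  proof -
    have lin: "sh (\<lambda>S. 1 * f n S + (- 1) * f k S) S = 1 * sh (f n) S + (- 1) * sh (f k) S" for S
      by (rule shifted_linear[OF f(1) f(1)])
    have "c * l2norm (\<lambda>S. 1 * f n S + (- 1) * f k S) \<le> l2norm (sh (\<lambda>S. 1 * f n S + (- 1) * f k S))"
      by (rule shifted_lower_bound[OF fin_vecs_linear[OF f(1) f(1)]])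
    also have "sh (\<lambda>S. 1 * f n S + (- 1) * f k S) = (\<lambda>S. sh (f n) S - sh (f k) S)"
      by (rule ext) (simp only: lin, simp)
    also have "l2norm \<dots> \<le> l2norm (\<lambda>S. sh (f n) S - p S) + l2norm (\<lambda>S. p S - sh (f k) S)"
      by (rule l2norm_triangle_diff[OF fs(2) ps fs(2)])
    also have "l2norm (\<lambda>S. p S - sh (f k) S) = l2norm (\<lambda>S. sh (f k) S - p S)"
      by (rule l2norm_minus_commute)
    finally show ?thesis using f(2)[of n] f(2)[of k] by simp
  qed
  obtain \<psi> where \<psi>: "square_summable \<psi>" "(\<lambda>n. l2norm (\<lambda>S. f n S - \<psi> S)) \<longlonglongrightarrow> 0"
    "\<And>S. (\<lambda>n. f n S) \<longlonglongrightarrow> \<psi> S"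
  proof (rule l2_complete[OF fs(1)])
    fix e :: real assume e: "e > 0"
    have "\<forall>\<^sub>F n in sequentially. 1 / Suc n < c * e / 2"
      by (rule order_tendstoD[OF inv0]) (use e c_pos in simp)
    then obtain N where N: "\<And>n. n \<ge> N \<Longrightarrow> 1 / Suc n < c * e / 2"
      by (auto simp: eventually_sequentially)
    have "l2norm (\<lambda>S. f n S - f k S) < e" if "n \<ge> N" "k \<ge> N" for n k
    proof -
      have "c * l2norm (\<lambda>S. f n S - f k S) < c * e"
        using cau[of n k] N[OF that(1)] N[OF that(2)] by linarith
      then show ?thesis using c_pos by (simp only: mult_less_cancel_left_pos)
    qed
    then show "\<exists>N. \<forall>n\<ge>N. \<forall>k\<ge>N. l2norm (\<lambda>S. f n S - f k S) < e" by blast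
  qed blast
  have \<psi>l2: "\<psi> \<in> l2 D"
  proof -
    have "\<psi> S = 0" if "S \<notin> configs D" for S
    proof -
      have "(\<lambda>n. f n S) = (\<lambda>n. 0)" using f(1) that by (auto simp: fin_vecs_def)
      with \<psi>(3)[of S] show ?thesis by (simp add: LIMSEQ_const_iff)
    qed
    with \<psi>(1) show ?thesis by (simp add: l2_iff)
  qed
  have \<eta>l2: "(\<lambda>S. p S + of_real \<mu> * \<psi> S) \<in> l2 D"
    using l2_linear[OF p \<psi>l2, of 1 "of_real \<mu>"] by simp
  have "(\<lambda>n. l2norm (\<lambda>S. ?H (f n) S - (p S + of_real \<mu> * \<psi> S))) \<longlonglongrightarrow> 0"
  proof (rule real_tendsto_sandwich[OF _ _ tendsto_const])
    show "\<forall>\<^sub>F n in sequentially. 0 \<le> l2norm (\<lambda>S. ?H (f n) S - (p S + of_real \<mu> * \<psi> S))" by simp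
    have "l2norm (\<lambda>S. ?H (f n) S - (p S + of_real \<mu> * \<psi> S))
        \<le> 1 / Suc n + \<mu> * l2norm (\<lambda>S. f n S - \<psi> S)" for n
    proof -
      have "l2norm (\<lambda>S. ?H (f n) S - (p S + of_real \<mu> * \<psi> S))
          = l2norm (\<lambda>S. (sh (f n) S - p S) + of_real \<mu> * (f n S - \<psi> S))"
        by (simp add: shifted_def algebra_simps)
      also have "\<dots> \<le> l2norm (\<lambda>S. sh (f n) S - p S) + l2norm (\<lambda>S. of_real \<mu> * (f n S - \<psi> S))"
        by (intro l2norm_sum_le(2) square_summable_scale square_summable_diff fs ps \<psi>(1))
      also have "l2norm (\<lambda>S. of_real \<mu> * (f n S - \<psi> S)) = \<mu> * l2norm (\<lambda>S. f n S - \<psi> S)"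
        using mu by (simp add: l2norm_scale)
      finally show ?thesis using f(2)[of n] by linarith
    qed
    then show "\<forall>\<^sub>F n in sequentially. l2norm (\<lambda>S. ?H (f n) S - (p S + of_real \<mu> * \<psi> S))
        \<le> 1 / Suc n + \<mu> * l2norm (\<lambda>S. f n S - \<psi> S)" by simp
    have "(\<lambda>n. 1 / Suc n + \<mu> * l2norm (\<lambda>S. f n S - \<psi> S)) \<longlonglongrightarrow> 0 + \<mu> * 0"
      by (intro tendsto_intros inv0 \<psi>(2))
    then show "(\<lambda>n. 1 / Suc n + \<mu> * l2norm (\<lambda>S. f n S - \<psi> S)) \<longlonglongrightarrow> 0" by simp
  qed
  with f(1) \<psi>(2) \<psi>l2 \<eta>l2 have "(\<psi>, \<lambda>S. p S + of_real \<mu> * \<psi> S) \<in> HD_graph lam D"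
    unfolding HD_graph_def mem_Collect_eq prod.case by (intro conjI exI[of _ f] allI)
  then show ?thesis by blast
qed

lemma graph_unique:
  assumes "(\<psi>1, \<lambda>S. p S + of_real \<mu> * \<psi>1 S) \<in> HD_graph lam D"
    and "(\<psi>2, \<lambda>S. p S + of_real \<mu> * \<psi>2 S) \<in> HD_graph lam D"
  shows "\<psi>1 = \<psi>2"
proof -
  let ?d = "\<lambda>S. 1 * \<psi>1 S + (- 1) * \<psi>2 S"
  let ?e = "\<lambda>S. 1 * (p S + of_real \<mu> * \<psi>1 S) + (- 1) * (p S + of_real \<mu> * \<psi>2 S)"
  have g: "(?d, ?e) \<in> HD_graph lam D" by (rule graph_linear[OF assms])
  have "(\<lambda>S. ?e S - of_real \<mu> * ?d S) = (\<lambda>S. 0)" by (rule ext) (simp add: algebra_simps)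
  with graph_lower_bound[OF g] have "c * l2norm ?d \<le> l2norm (\<lambda>S::(int^'d) set. 0)" by (simp only:)
  then have "l2norm ?d \<le> 0" using c_pos by (simp add: l2norm_def mult_le_0_iff)
  then have "l2norm ?d = 0" using l2norm_nonneg[of ?d] by linarith
  moreover have "square_summable ?d" using g by (simp add: HD_graph_def l2_iff)
  ultimately have "?d S = 0" for S using l2norm_eq_0[of ?d S] by blast
  then show ?thesis by (intro ext) (simp add: algebra_simps)
qed

text \<open>R picks the solution for each right-hand side. Uniqueness makes it linear and a left
  inverse, and the lower bound gives operator norm at most 1 / c.\<close>

lemma in_resolvent: "in_resolvent (HD_graph lam D) (l2 D) l2norm \<mu>"
proof -
  let ?G = "HD_graph lam D"
  obtain R where R: "\<And>p. p \<in> l2 D \<Longrightarrow> (R p, \<lambda>S. p S + of_real \<mu> * R p S) \<in> ?G"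
    using graph_solution by metis
  have eq: "R p = \<psi>" if "p \<in> l2 D" "(\<psi>, \<lambda>S. p S + of_real \<mu> * \<psi> S) \<in> ?G" for p \<psi>
    by (rule graph_unique[OF R[OF that(1)] that(2)])
  have 1: "R p \<in> l2 D" if "p \<in> l2 D" for p
    using R[OF that] by (simp add: HD_graph_def)
  have 2: "R (\<lambda>S. a * p S + b * q S) = (\<lambda>S. a * R p S + b * R q S)"
    if "p \<in> l2 D" "q \<in> l2 D" for p q a b
  proof (rule eq[OF l2_linear[OF that]])
    have "(\<lambda>S. a * p S + b * q S + of_real \<mu> * (a * R p S + b * R q S))
        = (\<lambda>S. a * (p S + of_real \<mu> * R p S) + b * (q S + of_real \<mu> * R q S))"
      by (rule ext) (simp add: algebra_simps)
    with graph_linear[OF R[OF that(1)] R[OF that(2)], of a b]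
    show "(\<lambda>S. a * R p S + b * R q S, \<lambda>S. a * p S + b * q S + of_real \<mu> * (a * R p S + b * R q S)) \<in> ?G"
      by (simp only:)
  qed
  have 3: "l2norm (R p) \<le> 1 / c * l2norm p" if "p \<in> l2 D" for p
    using graph_lower_bound[OF R[OF that]] c_pos by (simp add: pos_le_divide_eq mult.commute)
  have 4: "R (\<lambda>S. \<eta> S - of_real \<mu> * \<psi> S) = \<psi>" if "(\<psi>, \<eta>) \<in> ?G" for \<psi> \<eta>
  proof (rule eq)
    have "\<psi> \<in> l2 D" "\<eta> \<in> l2 D" using that by (auto simp: HD_graph_def)
    from l2_linear[OF this(2,1), of 1 "- of_real \<mu>"]
    show "(\<lambda>S. \<eta> S - of_real \<mu> * \<psi> S) \<in> l2 D" by simp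
    show "(\<psi>, \<lambda>S. \<eta> S - of_real \<mu> * \<psi> S + of_real \<mu> * \<psi> S) \<in> ?G" using that by simp
  qed
  show ?thesis
    unfolding in_resolvent_def
    by (intro exI[of _ R] conjI ballI allI exI[of _ "1 / c"] 1 2 3 R) (use 4 in blast)+
qed

end

theorem theorem2p2:
  fixes lam :: "real^'d" and m :: "real^'d"
  assumes "CARD('d) \<ge> 2"
    and "\<forall>j. lam$j > 0"
    and "norm m = 1"
    and "(\<chi> j. ln (lam$j)) \<noteq> - (norm (\<chi> j. ln (lam$j))) *\<^sub>R m"
  shows "spectral_gap (HD_spectrum lam (halfspace m)) > 0"
proof -
  let ?sp = "HD_spectrum lam (halfspace m)"
  obtain \<gamma> where \<gamma>: "\<gamma> > 0"
    and gap: "\<And>f. f \<in> fin_vecs (halfspace m) \<Longrightarrow>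
      \<gamma> * (\<Sum>S\<in>{S. f S \<noteq> 0} - {{}}. (cmod (f S))^2) \<le> energy lam (halfspace m) f"
    using energy_gap[OF _ assms(3,4)] assms(2) by blast
  have "\<mu> \<notin> ?sp" if "0 < \<mu>" "\<mu> < \<gamma>" for \<mu>
  proof -
    interpret gapped lam "halfspace m" \<gamma> \<mu>
      by (unfold_locales) (use gap that in auto)
    show ?thesis using in_resolvent by (simp add: HD_spectrum_def)
  qed
  then have *: "?sp \<inter> {0<..<\<gamma>} = {}" by auto
  \<comment> \<open>\<gamma> is itself one of the admissible \<delta>, so the supremum is at least
    \<gamma>.\<close>
  have "0 < ereal \<gamma>" using \<gamma> by simp
  also have "ereal \<gamma> \<le> Sup {ereal \<delta> | \<delta>. \<delta> > 0 \<and> ?sp \<inter> {0<..<\<delta>} = {}}"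
    by (rule Sup_upper) (use \<gamma> * in blast)
  also have "\<dots> = spectral_gap ?sp"
    unfolding spectral_gap_def using \<gamma> * by auto
  finally show ?thesis .
qed

end
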